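(* Let $X$ and $Y$ be real reflexive Banach spaces and let $K\subseteq X$, $\Lambda\subseteq Y$ be unbounded, closed and convex subsets with $0_X\in K$ and $0_Y\in\Lambda$. Let $f\in X^\ast$, $g\in Y^\ast$, and let $B:X\times Y\to\mathbb{R}$, $\chi:X\times X\to\mathbb{R}$ and $\psi:Y\times Y\to\mathbb{R}$ be functionals. Consider the following conditions. (B1): (i) for each $\lambda\in Y$, the mapping $u\mapsto B(u,\lambda)$ is convex and lower semicontinuous; (ii) for each $u\in X$, the mapping $\lambda\mapsto B(u,\lambda)$ is concave and upper semicontinuous. (B2): (i) for each $\mu\in Y$, the mapping $[u,\lambda]\mapsto 2B(u,\mu)-B(u,\lambda)$ is weakly lower semicontinuous on $X\times Y$; (ii) for each $v\in X$, the mapping $[u,\lambda]\mapsto 2B(v,\lambda)-B(u,\lambda)$ is concave on $X\times Y$. (X1): (i) for each $v\in X$, the mapping $u\mapsto\chi(u,v-u)$ is weakly upper semicontinuous; (ii) for each $u\in X$, the mapping $v\mapsto\chi(u,v)$ is convex; (iii) $\chi(u,0_X)=0$ for all $u\in X$. (X2): (i) $\chi(u,u-v)+\chi(v,v-u)\geq 0$ for all $u,v\in X$; (ii) for each $u,v,w\in X$, the mapping $[0,1]\ni t\mapsto\chi(u+t(v-u),w)$ is continuous at $0_+$; (iii) for each $u\in X$, $v\mapsto\chi(u,v)$ is concave, upper semicontinuous and positive homogeneous; (iv) $\chi(u,0_X)=0$ for all $u\in X$. (P1): (i) for each $\mu\in Y$, the mapping $\lambda\mapsto\psi(\lambda,\mu-\lambda)$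 is weakly upper semicontinuous; (ii) for each $\lambda\in Y$, the mapping $\mu\mapsto\psi(\lambda,\mu)$ is convex; (iii) $\psi(\lambda,0_Y)=0$ for all $\lambda\in Y$. (P2): (i) $\psi(\lambda,\lambda-\mu)+\psi(\mu,\mu-\lambda)\geq 0$ for all $\lambda,\mu\in Y$; (ii) for each $\lambda,\mu,\sigma\in Y$, the mapping $[0,1]\ni t\mapsto\psi(\lambda+t(\mu-\lambda),\sigma)$ is continuous at $0_+$; (iii) for each $\lambda\in Y$, $\mu\mapsto\psi(\lambda,\mu)$ is concave, upper semicontinuous and positive homogeneous; (iv) $\psi(\lambda,0_Y)=0$ for all $\lambda\in Y$. (C1): $\displaystyle\frac{\chi(u,-u)+\psi(\lambda,-\lambda)}{\sqrt{\|u\|_X^2+\|\lambda\|_Y^2}}\to-\infty$ as $\sqrt{\|u\|_X^2+\|\lambda\|_Y^2}\to\infty$. (C2): there exist $m_\chi,m_\psi>0$ and $p,q\geq 1$ such that (i) $\chi(u,-u)\leq m_\chi\|u\|_X^p$ for all $u\in X$; (ii) $\psi(\lambda,-\lambda)\leq m_\psi\|\lambda\|_Y^q$ for all $\lambda\in Y$; (iii) $\displaystyle\frac{B(0_X,\lambda)-B(u,0_Y)}{\left(\sqrt{\|u\|_X^2+\|\lambda\|_Y^2}\right)^{\max\{p,q\}}}\to-\infty$ as $\sqrt{\|u\|_X^2+\|\lambda\|_Y^2}\to\infty$. Assume that $\chi$ satisfies (X1) or (X2), that $\psi$ satisfies (P1) or (P2), and that one of the following holds: either (C1) and (B1) hold,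 or (C2) holds together with (B1) or (B2). Then there exists at least one $(u,\lambda)\in K\times\Lambda$ such that $$ \left\{ \begin{array}{ll} B(v,\lambda)-B(u,\lambda)+\chi(u,v-u)\geq\langle f,v-u\rangle, & \forall v\in K,\\ B(u,\lambda)-B(u,\mu)+\psi(\lambda,\mu-\lambda)\geq\langle g,\mu-\lambda\rangle, & \forall \mu\in\Lambda. \end{array} \right. $$
   Context: $X^\ast$, $Y^\ast$ denote the topological duals of $X$, $Y$, $\langle\cdot,\cdot\rangle$ the corresponding duality pairings, and $0_X$, $0_Y$ the zero elements. Elements of the product space $X\times Y$ are written $[u,\lambda]$. "Weakly" lower/upper semicontinuous means with respect to the weak topology. A function $p$ on a vector space is positive homogeneous if $p(tv)=t\,p(v)$ for all $t>0$ and all $v$. "Continuous at $0_+$" means that the value at $t$ tends to the value at $0$ as $t\to 0$, $t>0$. In (C1) and (C2)(iii) the limits are taken over $(u,\lambda)\in X\times Y$. *)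

theory Defs
  imports "HOL-Analysis.Analysis"
begin

section \<open>Duals, reflexivity and the weak topology\<close>

text \<open>
  The topological dual of a real normed space \<open>'a\<close> is the type \<open>'a \<Rightarrow>\<^sub>L real\<close> of bounded linear
  functionals, and the duality pairing of \<open>f\<close> and \<open>x\<close> is \<open>blinfun_apply f x\<close>.
\<close>

definition bidual_embedding ::
    "'a::real_normed_vector \<Rightarrow> (('a \<Rightarrow>\<^sub>L real) \<Rightarrow>\<^sub>L real)"
  where "bidual_embedding x = Blinfun (\<lambda>f. blinfun_apply f x)"

lemma blinfun_apply_bidual_embedding [simp]:
  "blinfun_apply (bidual_embedding x) f = blinfun_apply f x"
  unfolding bidual_embedding_def
  by (simp add: bounded_linear_Blinfun_apply blinfun.bounded_linear_left)

definition reflexive_space :: "'a::real_normed_vector itself \<Rightarrow> bool"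
  where "reflexive_space _ \<longleftrightarrow>
    surj (bidual_embedding :: 'a \<Rightarrow> (('a \<Rightarrow>\<^sub>L real) \<Rightarrow>\<^sub>L real))"

definition weak_topology :: "'a::real_normed_vector topology"
  where "weak_topology =
    topology_generated_by {blinfun_apply f -` U | (f :: 'a \<Rightarrow>\<^sub>L real) U. open U}"

lemma topspace_weak_topology [simp]: "topspace weak_topology = UNIV"
proof -
  have "UNIV \<in> {blinfun_apply f -` U | (f :: 'a::real_normed_vector \<Rightarrow>\<^sub>L real) U. open U}"
    by (intro CollectI exI[of _ 0] exI[of _ UNIV]) auto
  then show ?thesis
    unfolding weak_topology_def topology_generated_by_topspace by blast
qed

section \<open>Semicontinuity and homogeneity\<close>

definition lower_semicontinuous :: "'a topology \<Rightarrow> ('a \<Rightarrow> real) \<Rightarrow> bool"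
  where "lower_semicontinuous T h \<longleftrightarrow> (\<forall>c. openin T {x \<in> topspace T. c < h x})"

definition upper_semicontinuous :: "'a topology \<Rightarrow> ('a \<Rightarrow> real) \<Rightarrow> bool"
  where "upper_semicontinuous T h \<longleftrightarrow> (\<forall>c. openin T {x \<in> topspace T. h x < c})"

definition positive_homogeneous :: "('a::real_vector \<Rightarrow> real) \<Rightarrow> bool"
  where "positive_homogeneous h \<longleftrightarrow> (\<forall>t>0. \<forall>v. h (t *\<^sub>R v) = t * h v)"

section \<open>The conditions on the functionals\<close>

definition cond_B1 :: "('a::real_normed_vector \<Rightarrow> 'b::real_normed_vector \<Rightarrow> real) \<Rightarrow> bool"
  where "cond_B1 B \<longleftrightarrow>
    (\<forall>l. convex_on UNIV (\<lambda>u. B u l) \<and> lower_semicontinuous euclidean (\<lambda>u. B u l)) \<and>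
    (\<forall>u. concave_on UNIV (\<lambda>l. B u l) \<and> upper_semicontinuous euclidean (\<lambda>l. B u l))"

definition cond_B2 :: "('a::real_normed_vector \<Rightarrow> 'b::real_normed_vector \<Rightarrow> real) \<Rightarrow> bool"
  where "cond_B2 B \<longleftrightarrow>
    (\<forall>m. lower_semicontinuous weak_topology (\<lambda>(u, l). 2 * B u m - B u l)) \<and>
    (\<forall>v. concave_on UNIV (\<lambda>(u, l). 2 * B v l - B u l))"

text \<open>
  The conditions on \<open>psi\<close> are those on \<open>chi\<close> with \<open>'b\<close> in place of \<open>'a\<close>, so the next two
  predicates serve for both functionals.
\<close>

definition cond_X1 :: "('a::real_normed_vector \<Rightarrow> 'a \<Rightarrow> real) \<Rightarrow> bool"
  where "cond_X1 chi \<longleftrightarrow>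
    (\<forall>v. upper_semicontinuous weak_topology (\<lambda>u. chi u (v - u))) \<and>
    (\<forall>u. convex_on UNIV (\<lambda>v. chi u v)) \<and>
    (\<forall>u. chi u 0 = 0)"

definition cond_X2 :: "('a::real_normed_vector \<Rightarrow> 'a \<Rightarrow> real) \<Rightarrow> bool"
  where "cond_X2 chi \<longleftrightarrow>
    (\<forall>u v. chi u (u - v) + chi v (v - u) \<ge> 0) \<and>
    (\<forall>u v w. ((\<lambda>t. chi (u + t *\<^sub>R (v - u)) w) \<longlongrightarrow> chi u w) (at_right 0)) \<and>
    (\<forall>u. concave_on UNIV (\<lambda>v. chi u v) \<and>
         upper_semicontinuous euclidean (\<lambda>v. chi u v) \<and>
         positive_homogeneous (\<lambda>v. chi u v)) \<and>
    (\<forall>u. chi u 0 = 0)"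

text \<open>
  The norm of the product type is \<open>norm (u, l) = sqrt ((norm u)\<^sup>2 + (norm l)\<^sup>2)\<close> (\<open>norm_Pair\<close>), so
  \<open>at_infinity\<close> on \<open>'a \<times> 'b\<close> is the filter for \<open>sqrt ((norm u)\<^sup>2 + (norm l)\<^sup>2)\<close> tending to infinity.
\<close>

definition cond_C1 ::
    "('a::real_normed_vector \<Rightarrow> 'a \<Rightarrow> real) \<Rightarrow> ('b::real_normed_vector \<Rightarrow> 'b \<Rightarrow> real) \<Rightarrow> bool"
  where "cond_C1 chi psi \<longleftrightarrow>
    filterlim (\<lambda>(u, l). (chi u (- u) + psi l (- l)) / sqrt ((norm u)\<^sup>2 + (norm l)\<^sup>2))
      at_bot at_infinity"

definition cond_C2 ::
    "('a::real_normed_vector \<Rightarrow> 'b::real_normed_vector \<Rightarrow> real) \<Rightarrow>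
     ('a \<Rightarrow> 'a \<Rightarrow> real) \<Rightarrow> ('b \<Rightarrow> 'b \<Rightarrow> real) \<Rightarrow> bool"
  where "cond_C2 B chi psi \<longleftrightarrow>
    (\<exists>c > 0. \<exists>d > 0. \<exists>p \<ge> 1. \<exists>q \<ge> 1.
      (\<forall>u. chi u (- u) \<le> c * norm u powr p) \<and>
      (\<forall>l. psi l (- l) \<le> d * norm l powr q) \<and>
      filterlim (\<lambda>(u, l). (B 0 l - B u 0) / sqrt ((norm u)\<^sup>2 + (norm l)\<^sup>2) powr max p q)
        at_bot at_infinity)"

end

theory Submission
  imports Defs
begin

text \<open>
  Adding the two inequalities and choosing \<open>m = l\<close> or \<open>v = u\<close> shows that the system is equivalent to
  the single equilibrium problem of finding \<open>w = (u, l)\<close> in \<open>K \<times> L\<close> with \<open>F w z \<ge> 0\<close> for all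
  \<open>z = (v, m)\<close> in \<open>K \<times> L\<close>, where \<open>F w z\<close> is the sum of \<open>B v l - B u m\<close>, \<open>chi u (v - u)\<close>,
  \<open>psi l (m - l)\<close>, \<open>- f (v - u)\<close> and \<open>- g (m - l)\<close>. Restricting the two conditions in (B2) to slices of
  the product shows that they contain (B1) (\<open>cond_B2_imp_B1\<close>), so \<open>B\<close> is always a convex-concave
  functional, convex lower semicontinuous in its first and concave upper semicontinuous in its second
  argument.
  
  Suppose first that \<open>K\<close> and \<open>L\<close> are bounded. By reflexivity they are weakly compact
  (\<open>bounded_closed_convex_imp_weakly_compact\<close>), and the KKM principle (\<open>kkm\<close>) produces a common point
  of the sets \<open>{w. F w z \<ge> 0}\<close> as soon as these are weakly closed and every convex combination of
  points \<open>z\<^sub>i\<close> lies in the set of at least one of them. Under (X1) the term \<open>chi u (v - u)\<close>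
  satisfies both requirements directly. Under (X2) it need not be upper semicontinuous in \<open>u\<close> and is
  concave in \<open>v\<close>, so it is replaced by \<open>chi v (v - u)\<close>, which is concave and upper semicontinuous in
  \<open>u\<close>, hence weakly upper semicontinuous. Monotonicity compares the two terms at convex combinations,
  and Minty's linearization argument (\<open>monotone_linearization\<close>) returns from the new inequality to the
  original one. The predicate \<open>weak_substitute\<close> records what both cases have in common, and \<open>psi\<close> is
  treated in the same way, independently of \<open>chi\<close>.
  
  For unbounded sets the problem is solved on the intersections with a ball of radius \<open>R\<close>. Both
  growth conditions force \<open>F w 0 < 0\<close> for \<open>w\<close> of norm at least \<open>R\<close>, if \<open>R\<close> is large. A solution
  satisfies \<open>F w 0 \<ge> 0\<close>, so it lies strictly inside the ball. From there every point of \<open>K\<close> can be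
  approached a little way without leaving the ball, and convexity extends the inequality to all of
  \<open>K\<close> (\<open>interior_solution_is_global\<close>).
  
  Hahn-Banach separation comes from a Zorn argument on sublinear functionals, weak compactness from
  Tychonoff's theorem, and the KKM principle from Brouwer's theorem. The dimension in Brouwer's theorem is the number of points in a
  convex combination and cannot be fixed by a type, so Brouwer's theorem is proved for cubes in
  \<open>nat \<Rightarrow> real\<close> from the combinatorial lemma of Kuhn, which holds in every dimension.
\<close>

section \<open>Hahn-Banach separation\<close>

definition sublinear :: "('a::real_vector \<Rightarrow> real) \<Rightarrow> bool"
  where "sublinear p \<longleftrightarrow>
    (\<forall>x y. p (x + y) \<le> p x + p y) \<and> (\<forall>t>0. \<forall>x. p (t *\<^sub>R x) = t * p x)"

lemma sublinear_add: "sublinear p \<Longrightarrow> p (x + y) \<le> p x + p y"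
  and sublinear_scale: "sublinear p \<Longrightarrow> t > 0 \<Longrightarrow> p (t *\<^sub>R x) = t * p x"
  by (auto simp: sublinear_def)

lemma sublinear_0: "sublinear p \<Longrightarrow> p 0 = 0"
  using sublinear_scale[of p 2 0] by simp

lemma sublinear_lower: "sublinear p \<Longrightarrow> - p (- x) \<le> p x"
  using sublinear_add[of p x "- x"] sublinear_0[of p] by simp

text \<open>
  The functional \<open>q x = Inf {p (x + t c) - t d | t \<ge> 0, c \<in> D}\<close> is finite because
  \<open>p (x + t c) \<ge> t p c - p (- x)\<close> and \<open>p c \<ge> d\<close>; convexity of \<open>D\<close> makes it subadditive. This one construction serves
  twice: with a singleton \<open>D\<close> it shows that a minimal sublinear functional is odd, and with a translate
  of a convex set it encodes the separation constraint before minimality is invoked.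
\<close>

lemma sublinear_shrink:
  fixes p :: "'a::real_vector \<Rightarrow> real"
  assumes p: "sublinear p" and D: "convex D" "D \<noteq> {}" and d: "\<And>c. c \<in> D \<Longrightarrow> d \<le> p c"
  obtains q where "sublinear q" "\<And>x. q x \<le> p x" "\<And>c. c \<in> D \<Longrightarrow> q (- c) \<le> - d"
proof -
  define V where "V x = {p (x + t *\<^sub>R c) - t * d | t c. 0 \<le> t \<and> c \<in> D}" for x
  define q where "q x = Inf (V x)" for x
  obtain c0 where c0: "c0 \<in> D" using D by blast
  have lower: "- p (- x) \<le> r" if "r \<in> V x" for r x
  proof -
    from that obtain t c where r: "r = p (x + t *\<^sub>R c) - t * d" "0 \<le> t" "c \<in> D"
      by (auto simp: V_def)
    have "t * d \<le> t * p c" using d r by (simp add: mult_left_mono)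
    also have "\<dots> = p (t *\<^sub>R c)"
      using r sublinear_scale[OF p] sublinear_0[OF p] by (cases "t = 0") auto
    also have "\<dots> \<le> p (x + t *\<^sub>R c) + p (- x)"
      using sublinear_add[OF p, of "x + t *\<^sub>R c" "- x"] by simp
    finally show ?thesis using r by simp
  qed
  have mem: "p (x + t *\<^sub>R c) - t * d \<in> V x" if "0 \<le> t" "c \<in> D" for x t c
    using that by (auto simp: V_def)
  have bdd: "bdd_below (V x)" for x using lower by (rule bdd_belowI)
  have ne: "V x \<noteq> {}" for x using mem[OF order_refl c0] by blast
  have q_le: "q x \<le> p (x + t *\<^sub>R c) - t * d" if "0 \<le> t" "c \<in> D" for x t c
    unfolding q_def by (rule cInf_lower[OF mem[OF that] bdd])
  have q_ge: "r \<le> q x" if "\<And>t c. 0 \<le> t \<Longrightarrow> c \<in> D \<Longrightarrow> r \<le> p (x + t *\<^sub>R c) - t * d" for x r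
    unfolding q_def by (rule cInf_greatest[OF ne]) (use that in \<open>auto simp: V_def\<close>)
  have add: "q (x + y) \<le> q x + q y" for x y
  proof -
    \<comment> \<open>Two directions are merged into one, a convex combination of them weighted by \<open>t\<close> and \<open>s\<close>.\<close>
    have "q (x + y) - (p (x + t *\<^sub>R c) - t * d) \<le> q y" if t: "0 \<le> t" "c \<in> D" for t c
    proof (rule q_ge)
      fix s c' assume s: "0 \<le> (s::real)" "c' \<in> D"
      obtain e where e: "e \<in> D" "(t + s) *\<^sub>R e = t *\<^sub>R c + s *\<^sub>R c'"
      proof (cases "t + s = 0")
        case True
        then have "t = 0" "s = 0" using t s by auto
        then show ?thesis using that[OF c0] by simp
      next
        case False
        then have "(t / (t + s)) *\<^sub>R c + (s / (t + s)) *\<^sub>R c' \<in> D"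
          using t s by (intro convexD[OF D(1)]) (auto simp flip: add_divide_distrib)
        moreover have "(t + s) *\<^sub>R ((t / (t + s)) *\<^sub>R c + (s / (t + s)) *\<^sub>R c') = t *\<^sub>R c + s *\<^sub>R c'"
          using False by (simp add: scaleR_add_right)
        ultimately show ?thesis using that by blast
      qed
      have "q (x + y) \<le> p (x + y + (t + s) *\<^sub>R e) - (t + s) * d"
        using q_le[of "t + s" e] e t s by simp
      also have "x + y + (t + s) *\<^sub>R e = (x + t *\<^sub>R c) + (y + s *\<^sub>R c')"
        using e by simp
      also have "p \<dots> \<le> p (x + t *\<^sub>R c) + p (y + s *\<^sub>R c')"
        by (rule sublinear_add[OF p])
      finally show "q (x + y) - (p (x + t *\<^sub>R c) - t * d) \<le> p (y + s *\<^sub>R c') - s * d"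
        by (simp add: algebra_simps)
    qed
    then have "q (x + y) - q y \<le> q x"
      by (intro q_ge) (simp add: algebra_simps)
    then show ?thesis by simp
  qed
  have scale_le: "q (t *\<^sub>R x) \<le> t * q x" if "t > 0" for t x
  proof -
    have "q (t *\<^sub>R x) / t \<le> q x"
    proof (rule q_ge)
      fix s c assume s: "0 \<le> (s::real)" "c \<in> D"
      have "q (t *\<^sub>R x) \<le> p (t *\<^sub>R x + (t * s) *\<^sub>R c) - t * s * d"
        using s \<open>t > 0\<close> by (intro q_le) auto
      also have "t *\<^sub>R x + (t * s) *\<^sub>R c = t *\<^sub>R (x + s *\<^sub>R c)"
        by (simp add: scaleR_add_right)
      also have "p \<dots> - t * s * d = t * (p (x + s *\<^sub>R c) - s * d)"
        by (subst sublinear_scale[OF p \<open>t > 0\<close>]) (simp add: algebra_simps)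
      finally show "q (t *\<^sub>R x) / t \<le> p (x + s *\<^sub>R c) - s * d"
        using \<open>t > 0\<close> by (simp add: field_simps)
    qed
    then show ?thesis using \<open>t > 0\<close> by (simp add: field_simps)
  qed
  have scale: "q (t *\<^sub>R x) = t * q x" if "t > 0" for t x
    using scale_le[OF that, of x] scale_le[of "1 / t" "t *\<^sub>R x"] that by (simp add: field_simps)
  show thesis
  proof (rule that)
    show "sublinear q" using add scale by (auto simp: sublinear_def)
    show "q x \<le> p x" for x using q_le[OF order_refl c0, of x] by simp
    show "q (- c) \<le> - d" if "c \<in> D" for c
      using q_le[of 1 c "- c"] that sublinear_0[OF p] by simp
  qed
qed

text \<open>
  By Zorn's lemma: the pointwise infimum of a chain of sublinear functionals below \<open>p\<close> is finite,
  since each of them is at least \<open>- p (- x)\<close> at \<open>x\<close>, and it is sublinear again.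
\<close>

lemma minimal_sublinear_exists:
  fixes p :: "'a::real_vector \<Rightarrow> real"
  assumes p: "sublinear p"
  obtains q where "sublinear q" "q \<le> p" "\<And>r. sublinear r \<Longrightarrow> r \<le> q \<Longrightarrow> r = q"
proof -
  define A where "A = {q. sublinear q \<and> q \<le> p}"
  have "\<exists>m\<in>A. \<forall>a\<in>A. m \<ge> a \<longrightarrow> a = m"
  proof (rule predicate_Zorn)
    show "partial_order_on A (relation_of (\<ge>) A)"
      by (rule partial_order_on_relation_ofI) auto
    fix C assume C: "C \<in> Chains (relation_of (\<ge>) A)"
    show "\<exists>u\<in>A. \<forall>a\<in>C. a \<ge> u"
    proof (cases "C = {}")
      case True
      then show ?thesis using p by (auto simp: A_def)
    next
      case False
      have CA: "C \<subseteq> A" and chain: "\<And>a b. a \<in> C \<Longrightarrow> b \<in> C \<Longrightarrow> a \<le> b \<or> b \<le> a"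
        using C by (auto simp: Chains_def relation_of_def)
      have sub: "sublinear a" and below: "a \<le> p" if "a \<in> C" for a
        using CA that by (auto simp: A_def)
      have lower: "- p (- x) \<le> a x" if "a \<in> C" for a x
        using sublinear_lower[OF sub[OF that], of x] le_funD[OF below[OF that], of "- x"] by linarith
      define u where "u x = Inf ((\<lambda>a. a x) ` C)" for x
      have bdd: "bdd_below ((\<lambda>a. a x) ` C)" for x
        by (rule bdd_belowI[of _ "- p (- x)"]) (use lower in auto)
      have u_le: "u x \<le> a x" if "a \<in> C" for a x
        unfolding u_def by (rule cINF_lower[OF bdd that])
      have u_ge: "r \<le> u x" if "\<And>a. a \<in> C \<Longrightarrow> r \<le> a x" for r x
        unfolding u_def by (rule cINF_greatest[OF False that])
      have add: "u (x + y) \<le> u x + u y" for x y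
      proof -
        have "u (x + y) - a x \<le> u y" if a: "a \<in> C" for a
        proof (rule u_ge)
          fix b assume b: "b \<in> C"
          have "\<exists>e\<in>C. e x \<le> a x \<and> e y \<le> b y"
            using chain[OF a b] a b by (auto simp: le_fun_def)
          then obtain e where e: "e \<in> C" "e x \<le> a x" "e y \<le> b y" by blast
          then show "u (x + y) - a x \<le> b y"
            using u_le[OF e(1), of "x + y"] sublinear_add[OF sub[OF e(1)], of x y] by linarith
        qed
        then have "u (x + y) - u y \<le> u x" by (intro u_ge) (simp add: algebra_simps)
        then show ?thesis by simp
      qed
      have scale_le: "u (t *\<^sub>R x) \<le> t * u x" if "t > 0" for t x
      proof -
        have "u (t *\<^sub>R x) / t \<le> u x"
          using u_le[of _ "t *\<^sub>R x"] sublinear_scale[OF sub \<open>t > 0\<close>] \<open>t > 0\<close>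
          by (intro u_ge) (simp add: field_simps)
        then show ?thesis using \<open>t > 0\<close> by (simp add: field_simps)
      qed
      have scale: "u (t *\<^sub>R x) = t * u x" if "t > 0" for t x
        using scale_le[OF that, of x] scale_le[of "1 / t" "t *\<^sub>R x"] that by (simp add: field_simps)
      obtain a where "a \<in> C" using False by blast
      then have "u \<le> p" using u_le below by (meson le_funD le_funI order_trans)
      then have "u \<in> A" using add scale by (auto simp: A_def sublinear_def)
      then show ?thesis using u_le by (auto simp: le_fun_def)
    qed
  qed
  then obtain m where "m \<in> A" "\<And>a. a \<in> A \<Longrightarrow> a \<le> m \<Longrightarrow> a = m" by blast
  then show thesis
    by (intro that[of m]) (auto simp: A_def)
qed

text \<open>
  A minimal sublinear functional \<open>q\<close> is linear: shrinking it in the direction \<open>y\<close> with the constant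
  \<open>q y\<close> cannot change it, which forces \<open>q (- y) \<le> - q y\<close>. An odd sublinear functional is linear.
\<close>

lemma sublinear_dominates_linear:
  fixes p :: "'a::real_vector \<Rightarrow> real"
  assumes p: "sublinear p"
  obtains f where "linear f" "\<And>x. f x \<le> p x"
proof -
  obtain q where q: "sublinear q" "q \<le> p" and min: "\<And>r. sublinear r \<Longrightarrow> r \<le> q \<Longrightarrow> r = q"
    using minimal_sublinear_exists[OF p] by blast
  have odd: "q (- y) = - q y" for y
  proof -
    obtain r where r: "sublinear r" "\<And>x. r x \<le> q x" "r (- y) \<le> - q y"
      by (rule sublinear_shrink[OF q(1), of "{y}" "q y"]) auto
    then have "r = q" using min by (simp add: le_fun_def)
    then show ?thesis using r(3) sublinear_lower[OF q(1), of "- y"] by simp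
  qed
  have add: "q (x + y) = q x + q y" for x y
    using sublinear_add[OF q(1), of x y] sublinear_add[OF q(1), of "- x" "- y"] odd[of "x + y"]
    by (simp add: odd)
  have "q (t *\<^sub>R x) = t *\<^sub>R q x" for t x
  proof -
    consider "t > 0" | "t = 0" | "- t > 0" by linarith
    then show ?thesis
    proof cases
      case 3
      then show ?thesis using sublinear_scale[OF q(1), of "- t" x] odd[of "t *\<^sub>R x"] by simp
    qed (auto simp: sublinear_scale[OF q(1)] sublinear_0[OF q(1)])
  qed
  then have "linear q" using add by (intro linearI) auto
  then show thesis using that q(2) by (auto simp: le_fun_def)
qed

text \<open>
  Shrink the norm along \<open>D = C - x\<close> with \<open>d\<close> the distance from \<open>x\<close> to \<open>C\<close>, and take a linear
  functional below the result. Being below the norm it is continuous, and being at most \<open>- d\<close> on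
  \<open>- D\<close> it separates.
\<close>

lemma closed_convex_separation:
  fixes C :: "'a::real_normed_vector set"
  assumes C: "convex C" "closed C" and x: "x \<notin> C"
  obtains f :: "'a \<Rightarrow>\<^sub>L real" and d where "d > 0" "\<And>c. c \<in> C \<Longrightarrow> f x + d \<le> f c"
proof (cases "C = {}")
  case True
  then show thesis using that[of 1 0] by simp
next
  case False
  define D where "D = (\<lambda>c. c - x) ` C"
  define d where "d = infdist x C"
  have d: "d > 0"
    unfolding d_def using C False x by (metis in_closed_iff_infdist_zero infdist_nonneg less_le)
  have sub: "sublinear (norm :: 'a \<Rightarrow> real)"
    by (auto simp: sublinear_def norm_triangle_ineq)
  have cvx: "convex D" unfolding D_def using C by (simp add: convex_translation_subtract)
  have low: "d \<le> norm c" if "c \<in> D" for c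
    using that infdist_le[of _ C x] by (auto simp: d_def D_def dist_norm norm_minus_commute)
  obtain q where q: "sublinear q" "\<And>y. q y \<le> norm y" "\<And>c. c \<in> D \<Longrightarrow> q (- c) \<le> - d"
    using sublinear_shrink[OF sub cvx _ low] False unfolding D_def by blast
  obtain f where f: "linear f" "\<And>y. f y \<le> q y"
    using sublinear_dominates_linear[OF q(1)] by blast
  have neg: "f (- y) = - f y" for y using f(1) by (rule linear_neg)
  have "\<bar>f y\<bar> \<le> norm y" for y
    using f(2)[of y] f(2)[of "- y"] q(2)[of y] q(2)[of "- y"] by (auto simp: neg abs_if)
  then have bl: "bounded_linear f"
    using f(1) by (intro bounded_linear_intro[where K = 1]) (auto simp: linear_iff)
  show thesis
  proof (rule that[of d "Blinfun f"])
    fix c assume "c \<in> C"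
    then have "f (- (c - x)) \<le> - d" using f(2)[of "- (c - x)"] q(3)[of "c - x"] by (auto simp: D_def)
    then show "blinfun_apply (Blinfun f) x + d \<le> blinfun_apply (Blinfun f) c"
      using f(1) by (simp add: bounded_linear_Blinfun_apply[OF bl] neg linear_diff)
  qed (rule d)
qed

section \<open>The weak topology\<close>

lemma openin_weak_vimage:
  fixes f :: "'a::real_normed_vector \<Rightarrow>\<^sub>L real"
  shows "open U \<Longrightarrow> openin weak_topology (blinfun_apply f -` U)"
  unfolding weak_topology_def by (rule topology_generated_by_Basis) blast

lemma continuous_map_into_weak:
  assumes "\<And>f :: 'b::real_normed_vector \<Rightarrow>\<^sub>L real. continuous_map T euclidean (\<lambda>x. blinfun_apply f (h x))"
  shows "continuous_map T weak_topology h"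
  unfolding weak_topology_def
proof (rule continuous_on_generated_topo)
  fix W assume "W \<in> {blinfun_apply f -` U | (f :: 'b \<Rightarrow>\<^sub>L real) U. open U}"
  then obtain f :: "'b \<Rightarrow>\<^sub>L real" and U where W: "W = blinfun_apply f -` U" "open U" by blast
  have "openin T {x \<in> topspace T. blinfun_apply f (h x) \<in> U}"
    using assms[of f] W(2) by (simp add: openin_continuous_map_preimage)
  also have "{x \<in> topspace T. blinfun_apply f (h x) \<in> U} = h -` W \<inter> topspace T" using W by auto
  finally show "openin T (h -` W \<inter> topspace T)" .
next
  show "h ` topspace T \<subseteq> \<Union> {blinfun_apply f -` U | (f :: 'b \<Rightarrow>\<^sub>L real) U. open U}"
    using topspace_weak_topology[where 'a = 'b]
    unfolding weak_topology_def topology_generated_by_topspace by blast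
qed

lemma weakly_open_imp_open:
  assumes "openin weak_topology U"
  shows "open U"
proof -
  have "continuous_map euclidean weak_topology (\<lambda>x. x)"
    by (rule continuous_map_into_weak) (simp add: linear_continuous_on blinfun.bounded_linear_right)
  from openin_continuous_map_preimage[OF this assms] show ?thesis by simp
qed

text \<open>
  Mazur's theorem: the separating functional provides a weakly open half-space around each point
  outside \<open>C\<close>.
\<close>

lemma closed_convex_imp_weakly_closed:
  fixes C :: "'a::real_normed_vector set"
  assumes "convex C" "closed C"
  shows "closedin weak_topology C"
proof -
  have "\<exists>W. openin weak_topology W \<and> x \<in> W \<and> W \<subseteq> - C" if x: "x \<in> - C" for x
  proof (rule closed_convex_separation[OF assms ComplD[OF x]])
    fix f :: "'a \<Rightarrow>\<^sub>L real" and d assume d: "d > 0" and f: "\<And>c. c \<in> C \<Longrightarrow> f x + d \<le> f c"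
    show ?thesis
    proof (intro exI conjI)
      show "openin weak_topology (blinfun_apply f -` {..<f x + d})"
        by (rule openin_weak_vimage) simp
      show "x \<in> blinfun_apply f -` {..<f x + d}" using d by simp
      show "blinfun_apply f -` {..<f x + d} \<subseteq> - C"
        by (auto dest!: f)
    qed
  qed
  then have "openin weak_topology (- C)" by (subst openin_subopen) blast
  then show ?thesis by (simp add: closedin_def flip: Compl_eq_Diff_UNIV)
qed

lemma concave_usc_imp_weakly_usc:
  fixes h :: "'a::real_normed_vector \<Rightarrow> real"
  assumes "concave_on UNIV h" and "upper_semicontinuous euclidean h"
  shows "upper_semicontinuous weak_topology h"
  unfolding upper_semicontinuous_def
proof
  fix c
  have "{x. h x < c} = - {x. c \<le> h x}" by auto
  moreover have "convex {x. c \<le> h x}"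
  proof (rule convexI)
    fix x y and s t :: real
    assume "x \<in> {x. c \<le> h x}" "y \<in> {x. c \<le> h x}" and st: "0 \<le> s" "0 \<le> t" "s + t = 1"
    then have "s * c + t * c \<le> s * h x + t * h y" by (intro add_mono mult_left_mono) auto
    also have "\<dots> \<le> h (s *\<^sub>R x + t *\<^sub>R y)"
      using assms(1) st by (simp add: concave_on_iff)
    finally show "s *\<^sub>R x + t *\<^sub>R y \<in> {x. c \<le> h x}"
      using st by (simp flip: distrib_right)
  qed
  moreover have "closed {x. c \<le> h x}"
  proof -
    have "open {x. h x < c}" using assms(2) by (simp add: upper_semicontinuous_def)
    then show ?thesis using \<open>{x. h x < c} = - {x. c \<le> h x}\<close> by (simp add: closed_def)
  qed
  ultimately show "openin weak_topology {x \<in> topspace weak_topology. h x < c}"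
    using closed_convex_imp_weakly_closed by (auto simp: closedin_def simp flip: Compl_eq_Diff_UNIV)
qed

lemma reflexive_represents:
  fixes \<phi> :: "('a::real_normed_vector \<Rightarrow>\<^sub>L real) \<Rightarrow> real"
  assumes "reflexive_space TYPE('a)" "bounded_linear \<phi>"
  shows "\<exists>x. \<forall>f. blinfun_apply f x = \<phi> f"
proof -
  obtain x :: 'a where x: "Blinfun \<phi> = bidual_embedding x"
    using surjD[OF assms(1)[unfolded reflexive_space_def], of "Blinfun \<phi>"] by blast
  have "blinfun_apply f x = \<phi> f" for f
    using fun_cong[OF bounded_linear_Blinfun_apply[OF assms(2)], of f] by (simp add: x)
  then show ?thesis by blast
qed

text \<open>
  The functionals \<open>\<phi>\<close> on the dual that are linear and satisfy \<open>\<bar>\<phi> f\<bar> \<le> R \<parallel>f\<parallel>\<close> form a closed subset of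
  a product of compact intervals. By reflexivity each of them is evaluation at a point, and passing
  to that point is continuous into the weak topology. So the points obtained form a weakly
  compact set, which contains \<open>C\<close>, and \<open>C\<close> is weakly closed in it.
\<close>

lemma bounded_closed_convex_imp_weakly_compact:
  fixes C :: "'a::real_normed_vector set"
  assumes refl: "reflexive_space TYPE('a)" and C: "convex C" "closed C" "bounded C"
  shows "compactin weak_topology C"
proof -
  obtain R where R: "\<And>x. x \<in> C \<Longrightarrow> norm x \<le> R"
    using C(3) unfolding bounded_iff by blast
  define P :: "(('a \<Rightarrow>\<^sub>L real) \<Rightarrow> real) set" where "P = (\<Pi>\<^sub>E f\<in>UNIV. cball 0 (R * norm f))"
  define L :: "(('a \<Rightarrow>\<^sub>L real) \<Rightarrow> real) set"
    where "L = {\<phi>. (\<forall>f g. \<phi> (f + g) = \<phi> f + \<phi> g) \<and> (\<forall>t f. \<phi> (t *\<^sub>R f) = t * \<phi> f)}"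
  have "compactin (product_topology (\<lambda>f. euclidean) UNIV) P"
    unfolding P_def by (subst compactin_PiE) auto
  then have "compact P" by (simp add: euclidean_product_topology)
  moreover have "closed L"
    unfolding L_def
    by (intro closed_Collect_conj closed_Collect_all closed_Collect_eq continuous_intros) auto
  ultimately have cpt: "compact (P \<inter> L)" by (rule compact_Int_closed)
  define E where "E \<phi> = (SOME x :: 'a. \<forall>f. blinfun_apply f x = \<phi> f)"
    for \<phi> :: "('a \<Rightarrow>\<^sub>L real) \<Rightarrow> real"
  have E: "blinfun_apply f (E \<phi>) = \<phi> f" if "\<phi> \<in> P \<inter> L" for \<phi> f
  proof -
    have "bounded_linear \<phi>"
      by (rule bounded_linear_intro[where K = R])
        (use that in \<open>auto simp: L_def P_def PiE_iff mult.commute\<close>)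
    from someI_ex[OF reflexive_represents[OF refl this]] show ?thesis unfolding E_def by (rule spec)
  qed
  have "continuous_map (top_of_set (P \<inter> L)) weak_topology E"
  proof (rule continuous_map_into_weak)
    fix f :: "'a \<Rightarrow>\<^sub>L real"
    have "continuous_on (P \<inter> L) (\<lambda>\<phi>. \<phi> f)"
      by (rule continuous_on_subset[OF continuous_on_product_coordinates]) simp
    then have "continuous_on (P \<inter> L) (\<lambda>\<phi>. blinfun_apply f (E \<phi>))"
      by (rule continuous_on_eq) (simp only: E)
    then show "continuous_map (top_of_set (P \<inter> L)) euclidean (\<lambda>\<phi>. blinfun_apply f (E \<phi>))"
      by simp
  qed
  then have "compactin weak_topology (E ` (P \<inter> L))"
    by (rule image_compactin[rotated]) (use cpt in \<open>simp add: compactin_subtopology\<close>)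
  moreover have "C \<subseteq> E ` (P \<inter> L)"
  proof
    fix x assume x: "x \<in> C"
    define \<phi> where "\<phi> f = blinfun_apply f x" for f :: "'a \<Rightarrow>\<^sub>L real"
    have "\<bar>blinfun_apply f x\<bar> \<le> R * norm f" for f :: "'a \<Rightarrow>\<^sub>L real"
      using norm_blinfun[of f x] mult_left_mono[OF R[OF x], of "norm f"] by (simp add: mult.commute)
    then have \<phi>: "\<phi> \<in> P \<inter> L"
      by (auto simp: \<phi>_def P_def L_def blinfun.add_left blinfun.scaleR_left)
    \<comment> \<open>The choice made by \<open>E\<close> is forced, because functionals separate points.\<close>
    have "E \<phi> = x"
    proof (rule ccontr)
      assume "E \<phi> \<noteq> x"
      then obtain f :: "'a \<Rightarrow>\<^sub>L real" and d where "d > 0" "f (E \<phi>) + d \<le> f x"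
        using closed_convex_separation[of "{x}" "E \<phi>"] by (metis closed_singleton convex_singleton singletonD singletonI)
      then show False using E[OF \<phi>, of f] by (simp add: \<phi>_def)
    qed
    then show "x \<in> E ` (P \<inter> L)" using \<phi> by blast
  qed
  ultimately show ?thesis
    using closed_convex_imp_weakly_closed[OF C(1,2)] closed_compactin by blast
qed

section \<open>Brouwer's theorem on cubes of arbitrary dimension\<close>

text \<open>
  Setting the coordinates from \<open>n\<close> on to zero, rather than leaving them free, makes the cube compact
  and a map into it determined by its first \<open>n\<close> coordinates.
\<close>

definition unit_cube :: "nat \<Rightarrow> (nat \<Rightarrow> real) set"
  where "unit_cube n = {x. (\<forall>i<n. 0 \<le> x i \<and> x i \<le> 1) \<and> (\<forall>i\<ge>n. x i = 0)}"

lemma compact_unit_cube: "compact (unit_cube n)"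
proof -
  have "unit_cube n = (\<Pi>\<^sub>E i\<in>UNIV. if i < n then {0..1} else {0})"
    by (auto simp: unit_cube_def PiE_iff split: if_splits)
  moreover have "compactin (product_topology (\<lambda>i::nat. euclidean) UNIV)
      (\<Pi>\<^sub>E i\<in>UNIV. if i < n then {0..1} else {0::real})"
    by (subst compactin_PiE) auto
  ultimately show ?thesis by (simp add: euclidean_product_topology)
qed

lemma tendsto_coordinatewise_fun:
  fixes h :: "'c \<Rightarrow> 'i \<Rightarrow> 'b::topological_space"
  assumes "\<And>i. ((\<lambda>k. h k i) \<longlongrightarrow> l i) F"
  shows "(h \<longlongrightarrow> l) F"
proof -
  have "limitin (product_topology (\<lambda>i. euclidean) UNIV) h l F"
    using assms by (simp add: limitin_componentwise)
  then show ?thesis by (simp add: euclidean_product_topology)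
qed

lemma tendsto_coordinate:
  fixes h :: "'c \<Rightarrow> 'i \<Rightarrow> 'b::topological_space"
  assumes "(h \<longlongrightarrow> l) F"
  shows "((\<lambda>k. h k i) \<longlongrightarrow> l i) F"
  by (rule continuous_on_tendsto_compose[OF continuous_on_product_coordinates assms]) auto

text \<open>
  Label a point in direction \<open>i\<close> by 0 if \<open>\<phi>\<close> does not decrease its coordinate \<open>i\<close>, and by 1 if \<open>\<phi>\<close> does not
  increase it. Kuhn's lemma finds on each grid a small cube in which, for every direction, both labels
  occur. Along a convergent subsequence of these cubes continuity gives both inequalities between
  \<open>\<phi> x i\<close> and \<open>x i\<close> at the limit \<open>x\<close>.
\<close>

lemma brouwer_unit_cube:
  fixes \<phi> :: "(nat \<Rightarrow> real) \<Rightarrow> nat \<Rightarrow> real"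
  assumes cont: "continuous_on (unit_cube n) \<phi>" and maps: "\<phi> ` unit_cube n \<subseteq> unit_cube n"
  shows "\<exists>x\<in>unit_cube n. \<phi> x = x"
proof -
  have "\<exists>l. (\<forall>x i. l x i \<le> (1::nat)) \<and>
     (\<forall>x i. x \<in> unit_cube n \<and> i < n \<and> x i = 0 \<longrightarrow> l x i = 0) \<and>
     (\<forall>x i. x \<in> unit_cube n \<and> i < n \<and> x i = 1 \<longrightarrow> l x i = 1) \<and>
     (\<forall>x i. x \<in> unit_cube n \<and> i < n \<and> l x i = 0 \<longrightarrow> x i \<le> \<phi> x i) \<and>
     (\<forall>x i. x \<in> unit_cube n \<and> i < n \<and> l x i = 1 \<longrightarrow> \<phi> x i \<le> x i)"
    by (rule kuhn_labelling_lemma') (use maps in \<open>auto simp: unit_cube_def\<close>)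
  then obtain l :: "(nat \<Rightarrow> real) \<Rightarrow> nat \<Rightarrow> nat" where
    l_le: "\<And>x i. l x i \<le> 1" and
    l_bottom: "\<And>x i. x \<in> unit_cube n \<Longrightarrow> i < n \<Longrightarrow> x i = 0 \<Longrightarrow> l x i = 0" and
    l_top: "\<And>x i. x \<in> unit_cube n \<Longrightarrow> i < n \<Longrightarrow> x i = 1 \<Longrightarrow> l x i = 1" and
    l_up: "\<And>x i. x \<in> unit_cube n \<Longrightarrow> i < n \<Longrightarrow> l x i = 0 \<Longrightarrow> x i \<le> \<phi> x i" and
    l_down: "\<And>x i. x \<in> unit_cube n \<Longrightarrow> i < n \<Longrightarrow> l x i = 1 \<Longrightarrow> \<phi> x i \<le> x i"
    by blast
  define grid where "grid p q = (\<lambda>i. if i < n then real (q i) / real p else 0)" for p :: nat and q :: "nat \<Rightarrow> nat"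
  have grid_cube: "grid p q \<in> unit_cube n" if "0 < p" "\<And>i. i < n \<Longrightarrow> q i \<le> p" for p q
    using that by (auto simp: grid_def unit_cube_def)
  \<comment> \<open>The edges are cut into \<open>Suc p\<close> pieces, since Kuhn's lemma needs a positive number of them.\<close>
  have ex: "\<exists>q. (\<forall>i<n. q i < Suc p) \<and> (\<forall>i<n. \<exists>r s.
      (\<forall>j<n. q j \<le> r j \<and> r j \<le> q j + 1) \<and> (\<forall>j<n. q j \<le> s j \<and> s j \<le> q j + 1) \<and>
      l (grid (Suc p) r) i \<noteq> l (grid (Suc p) s) i)" for p
  proof -
    have lab: "l (grid (Suc p) x) i = 0 \<or> l (grid (Suc p) x) i = 1" for x i
      using l_le[of "grid (Suc p) x" i] by linarith
    have bot: "l (grid (Suc p) x) i = 0" if "\<forall>i<n. x i \<le> Suc p" "i < n" "x i = 0" for x i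
      using that by (intro l_bottom grid_cube) (auto simp: grid_def)
    have top: "l (grid (Suc p) x) i = 1" if "\<forall>i<n. x i \<le> Suc p" "i < n" "x i = Suc p" for x i
      using that by (intro l_top grid_cube) (auto simp: grid_def)
    show ?thesis
      by (rule kuhn_lemma[of "Suc p" n "\<lambda>x. l (grid (Suc p) x)"]) (use lab bot top in auto)
  qed
  obtain q where qs: "\<forall>p. (\<forall>i<n. q p i < Suc p) \<and> (\<forall>i<n. \<exists>r s.
      (\<forall>j<n. q p j \<le> r j \<and> r j \<le> q p j + 1) \<and> (\<forall>j<n. q p j \<le> s j \<and> s j \<le> q p j + 1) \<and>
      l (grid (Suc p) r) i \<noteq> l (grid (Suc p) s) i)"
    using choice[OF allI[OF ex]] by (rule exE)
  have q: "q p i < Suc p" if "i < n" for p i using qs that by blast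
  define near where "near p r \<longleftrightarrow> (\<forall>j<n. q p j \<le> r j \<and> r j \<le> q p j + 1)" for p r
  have ends: "\<exists>r s. near p r \<and> near p s \<and> l (grid (Suc p) r) i \<noteq> l (grid (Suc p) s) i"
    if "i < n" for p i
    using qs that unfolding near_def by blast
  have near_cube: "grid (Suc p) r \<in> unit_cube n" if "near p r" for p r
  proof (rule grid_cube)
    fix i assume "i < n"
    then have "r i \<le> q p i + 1" "q p i < Suc p" using that q by (auto simp: near_def)
    then show "r i \<le> Suc p" by simp
  qed simp
  have ends': "(\<exists>r. near p r \<and> grid (Suc p) r i \<le> \<phi> (grid (Suc p) r) i) \<and>
      (\<exists>s. near p s \<and> \<phi> (grid (Suc p) s) i \<le> grid (Suc p) s i)" if i: "i < n" for p i
  proof -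
    obtain r s where rs: "near p r" "near p s" "l (grid (Suc p) r) i \<noteq> l (grid (Suc p) s) i"
      using ends[OF i] by blast
    consider "l (grid (Suc p) r) i = 0" "l (grid (Suc p) s) i = 1"
      | "l (grid (Suc p) s) i = 0" "l (grid (Suc p) r) i = 1"
      using rs(3) l_le[of "grid (Suc p) r" i] l_le[of "grid (Suc p) s" i] by linarith
    then show ?thesis
    proof cases
      case 1
      then show ?thesis
        using rs(1,2) l_up[OF near_cube[OF rs(1)] i] l_down[OF near_cube[OF rs(2)] i] by blast
    next
      case 2
      then show ?thesis
        using rs(1,2) l_up[OF near_cube[OF rs(2)] i] l_down[OF near_cube[OF rs(1)] i] by blast
    qed
  qed
  have "\<forall>p. grid (Suc p) (q p) \<in> unit_cube n"
    by (simp add: near_cube near_def)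
  then obtain x \<sigma> where x: "x \<in> unit_cube n" and \<sigma>: "strict_mono \<sigma>"
    and lim: "((\<lambda>p. grid (Suc p) (q p)) \<circ> \<sigma>) \<longlonglongrightarrow> x"
    using seq_compactE[OF compact_imp_seq_compact[OF compact_unit_cube],
        of "\<lambda>p. grid (Suc p) (q p)"] by blast
  have lim_near: "(\<lambda>k. grid (Suc (\<sigma> k)) (r (\<sigma> k))) \<longlonglongrightarrow> x" if r: "\<And>p. near p (r p)" for r
  proof (rule tendsto_coordinatewise_fun)
    fix j
    have lim_j: "(\<lambda>k. grid (Suc (\<sigma> k)) (q (\<sigma> k)) j) \<longlonglongrightarrow> x j"
      using tendsto_coordinate[OF lim, of j] by (simp add: o_def)
    have step: "(\<lambda>k. 1 / real (Suc (\<sigma> k))) \<longlonglongrightarrow> 0"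
      using LIMSEQ_subseq_LIMSEQ[OF LIMSEQ_inverse_real_of_nat \<sigma>]
      by (simp add: o_def inverse_eq_divide)
    show "(\<lambda>k. grid (Suc (\<sigma> k)) (r (\<sigma> k)) j) \<longlonglongrightarrow> x j"
    proof (rule tendsto_sandwich[OF _ _ lim_j])
      show "(\<lambda>k. grid (Suc (\<sigma> k)) (q (\<sigma> k)) j + 1 / real (Suc (\<sigma> k))) \<longlonglongrightarrow> x j"
        using tendsto_add[OF lim_j step] by simp
      show "\<forall>\<^sub>F k in sequentially. grid (Suc (\<sigma> k)) (q (\<sigma> k)) j \<le> grid (Suc (\<sigma> k)) (r (\<sigma> k)) j"
        using r by (auto intro!: always_eventually divide_right_mono simp: grid_def near_def)
      have "real (r p j) \<le> real (q p j) + 1" if "j < n" for p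
        using r[of p] that unfolding near_def by fastforce
      then show "\<forall>\<^sub>F k in sequentially. grid (Suc (\<sigma> k)) (r (\<sigma> k)) j
          \<le> grid (Suc (\<sigma> k)) (q (\<sigma> k)) j + 1 / real (Suc (\<sigma> k))"
        by (auto intro!: always_eventually divide_right_mono simp: grid_def simp flip: add_divide_distrib)
    qed
  qed
  have lim_\<phi>: "(\<lambda>k. \<phi> (grid (Suc (\<sigma> k)) (r (\<sigma> k))) i) \<longlonglongrightarrow> \<phi> x i"
    if r: "\<And>p. near p (r p)" for r i
    by (rule tendsto_coordinate, rule continuous_on_tendsto_compose[OF cont lim_near[OF r] x])
      (simp add: near_cube r)
  have "\<phi> x i = x i" for i
  proof (cases "i < n")
    case True
    have "\<exists>r. \<forall>p. near p (r p) \<and> grid (Suc p) (r p) i \<le> \<phi> (grid (Suc p) (r p)) i"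
      using ends'[OF True] by (intro choice) blast
    then obtain r where r: "\<And>p. near p (r p)"
      "\<And>p. grid (Suc p) (r p) i \<le> \<phi> (grid (Suc p) (r p)) i" by blast
    have "\<exists>s. \<forall>p. near p (s p) \<and> \<phi> (grid (Suc p) (s p)) i \<le> grid (Suc p) (s p) i"
      using ends'[OF True] by (intro choice) blast
    then obtain s where s: "\<And>p. near p (s p)"
      "\<And>p. \<phi> (grid (Suc p) (s p)) i \<le> grid (Suc p) (s p) i" by blast
    have "x i \<le> \<phi> x i"
      by (rule LIMSEQ_le[OF tendsto_coordinate[OF lim_near[OF r(1)]] lim_\<phi>[OF r(1)]])
        (use r(2) in auto)
    moreover have "\<phi> x i \<le> x i"
      by (rule LIMSEQ_le[OF lim_\<phi>[OF s(1)] tendsto_coordinate[OF lim_near[OF s(1)]]])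
        (use s(2) in auto)
    ultimately show ?thesis by simp
  next
    case False
    then show ?thesis using x maps by (auto simp: unit_cube_def image_subset_iff)
  qed
  then show ?thesis using x by blast
qed

section \<open>The Knaster-Kuratowski-Mazurkiewicz principle\<close>

definition nat_simplex :: "nat \<Rightarrow> (nat \<Rightarrow> real) set"
  where "nat_simplex n = {x. (\<forall>i. 0 \<le> x i) \<and> (\<forall>i\<ge>n. x i = 0) \<and> (\<Sum>i<n. x i) = 1}"

lemma nat_simplex_subset_unit_cube: "nat_simplex n \<subseteq> unit_cube n"
proof
  fix x assume x: "x \<in> nat_simplex n"
  then have "x i \<le> 1" if "i < n" for i
    using member_le_sum[of i "{..<n}" x] that by (auto simp: nat_simplex_def)
  then show "x \<in> unit_cube n" using x by (auto simp: nat_simplex_def unit_cube_def)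
qed

text \<open>
  A continuous retraction of the cube onto the simplex: a coordinate sum below 1 is topped up
  equally in all coordinates, a sum above 1 is scaled down. The first step keeps the denominator
  away from zero, which plain normalization would not.
\<close>

definition simplex_retract :: "nat \<Rightarrow> (nat \<Rightarrow> real) \<Rightarrow> nat \<Rightarrow> real"
  where "simplex_retract n x = (\<lambda>i. if i < n then
    (x i + max 0 (1 - (\<Sum>j<n. x j)) / n) / max 1 (\<Sum>j<n. x j) else 0)"

lemma simplex_retract_in:
  assumes "0 < n" "x \<in> unit_cube n"
  shows "simplex_retract n x \<in> nat_simplex n"
proof -
  have "(\<Sum>i<n. simplex_retract n x i)
      = (\<Sum>i<n. x i + max 0 (1 - (\<Sum>j<n. x j)) / n) / max 1 (\<Sum>j<n. x j)"
    by (simp add: simplex_retract_def sum_divide_distrib)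
  also have "(\<Sum>i<n. x i + max 0 (1 - (\<Sum>j<n. x j)) / n) = (\<Sum>j<n. x j) + max 0 (1 - (\<Sum>j<n. x j))"
    using assms(1) by (simp add: sum.distrib)
  also have "\<dots> / max 1 (\<Sum>j<n. x j) = 1" by (auto simp: max_def)
  finally show ?thesis
    using assms(2) by (auto simp: nat_simplex_def simplex_retract_def unit_cube_def
        intro!: divide_nonneg_nonneg add_nonneg_nonneg)
qed

lemma simplex_retract_id: "x \<in> nat_simplex n \<Longrightarrow> simplex_retract n x = x"
  by (auto simp: simplex_retract_def nat_simplex_def fun_eq_iff)

lemma continuous_simplex_retract: "continuous_on S (simplex_retract n)"
proof (rule continuous_on_coordinatewise_then_product)
  fix i
  have coord: "continuous_on S (\<lambda>x. x j)" for j :: nat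
    by (rule continuous_on_subset[OF continuous_on_product_coordinates]) simp
  show "continuous_on S (\<lambda>x. simplex_retract n x i)"
    by (cases "i < n") (auto simp: simplex_retract_def intro!: continuous_intros coord)
qed

text \<open>
  If the sets had no common point in the simplex, normalizing the distances to them would give a
  continuous self-map of the simplex. At a fixed point a coordinate is positive exactly when the
  point is outside the corresponding set, contrary to the covering hypothesis.
\<close>

lemma kkm_nat_simplex:
  fixes A :: "nat \<Rightarrow> (nat \<Rightarrow> real) set"
  assumes n: "0 < n" and closed: "\<And>i. i < n \<Longrightarrow> closed (A i)"
    and cover: "\<And>x. x \<in> nat_simplex n \<Longrightarrow> \<exists>i<n. 0 < x i \<and> x \<in> A i"
  shows "\<exists>x\<in>nat_simplex n. \<forall>i<n. x \<in> A i"
proof (rule ccontr)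
  assume no: "\<not> ?thesis"
  \<comment> \<open>The distance to an empty set is 0 by convention, so nonemptiness of the sets matters.\<close>
  have vertex: "(\<lambda>j. if j = i then 1 else 0) \<in> A i" if "i < n" for i
  proof -
    have "(\<lambda>j. if j = i then 1 else 0) \<in> nat_simplex n"
      using that by (auto simp: nat_simplex_def)
    from cover[OF this] show ?thesis by (auto split: if_splits)
  qed
  define d where "d x = (\<lambda>i. if i < n then infdist x (A i) else 0)" for x
  have d_nonneg: "0 \<le> d x i" for x i by (simp add: d_def infdist_nonneg)
  have d_0: "d x i = 0 \<longleftrightarrow> x \<in> A i" if "i < n" for x i
    using that in_closed_iff_infdist_zero[OF closed[OF that]] vertex[OF that] by (auto simp: d_def)
  have d_sum: "0 < (\<Sum>i<n. d x i)" if x: "x \<in> nat_simplex n" for x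
  proof -
    obtain i where i: "i < n" "x \<notin> A i" using no x by blast
    then have "0 < d x i" using d_0[of i x] d_nonneg[of x i] by simp
    then show ?thesis using i d_nonneg by (intro sum_pos2[of _ i]) auto
  qed
  define \<psi> where "\<psi> x = (\<lambda>i. d x i / (\<Sum>j<n. d x j))" for x
  have \<psi>: "\<psi> x \<in> nat_simplex n" if "x \<in> nat_simplex n" for x
    using d_sum[OF that] d_nonneg
    by (auto simp: nat_simplex_def \<psi>_def sum_nonneg simp flip: sum_divide_distrib)
      (simp add: d_def)
  have cont_d: "continuous_on (nat_simplex n) (\<lambda>x. d x i)" for i
    by (cases "i < n") (auto simp: d_def intro!: continuous_intros)
  have cont_\<psi>: "continuous_on (nat_simplex n) \<psi>"
    unfolding \<psi>_def using d_sum
    by (intro continuous_on_coordinatewise_then_product continuous_on_divide continuous_on_sum cont_d)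
      fastforce
  have ret: "simplex_retract n ` unit_cube n \<subseteq> nat_simplex n"
    using simplex_retract_in[OF n] by blast
  have "continuous_on (unit_cube n) (\<lambda>x. \<psi> (simplex_retract n x))"
    by (rule continuous_on_compose2[OF cont_\<psi> continuous_simplex_retract ret])
  moreover have "(\<lambda>x. \<psi> (simplex_retract n x)) ` unit_cube n \<subseteq> unit_cube n"
    using \<psi> ret nat_simplex_subset_unit_cube by blast
  ultimately obtain x where x: "x \<in> unit_cube n" "\<psi> (simplex_retract n x) = x"
    using brouwer_unit_cube by blast
  then have xs: "x \<in> nat_simplex n" using \<psi> ret by force
  then have fixed: "\<psi> x = x" using x simplex_retract_id by metis
  obtain i where i: "i < n" "0 < x i" "x \<in> A i" using cover[OF xs] by blast
  then have "\<psi> x i = 0" using d_0[of i x] by (simp add: \<psi>_def)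
  then show False using i fixed by simp
qed

text \<open>
  Compactness reduces the claim to finitely many points \<open>z i\<close>, and pulling the sets back along
  \<open>x \<mapsto> \<Sum>i<n. x i *\<^sub>R z i\<close> reduces that to the simplex. This map is continuous into the norm
  topology, so it is enough that the topology \<open>T\<close> is coarser than the norm topology.
\<close>

lemma kkm:
  fixes G :: "'a::real_normed_vector \<Rightarrow> 'a set"
  assumes coarser: "\<And>W. openin T W \<Longrightarrow> open W" and top: "topspace T = UNIV"
    and C: "compactin T C" "convex C" "C \<noteq> {}"
    and closed: "\<And>z. z \<in> C \<Longrightarrow> closedin T (G z)"
    and cover: "\<And>I z t. finite I \<Longrightarrow> (\<And>i. i \<in> I \<Longrightarrow> z i \<in> C) \<Longrightarrow> (\<And>i. i \<in> I \<Longrightarrow> 0 < t i) \<Longrightarrow>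
      sum t I = 1 \<Longrightarrow> \<exists>i\<in>I. (\<Sum>i\<in>I. t i *\<^sub>R z i) \<in> G (z (i :: nat))"
  shows "\<exists>w\<in>C. \<forall>z\<in>C. w \<in> G z"
proof -
  have closed': "closed (G z)" if "z \<in> C" for z
    using closed[OF that] coarser by (auto simp: closedin_def top closed_def simp flip: Compl_eq_Diff_UNIV)
  have "C \<inter> \<Inter>\<F> \<noteq> {}" if F: "finite \<F>" "\<F> \<subseteq> G ` C" for \<F>
  proof (cases "\<F> = {}")
    case True
    then show ?thesis using C by simp
  next
    case False
    obtain Z where Z: "Z \<subseteq> C" "finite Z" "\<F> = G ` Z" using finite_subset_image[OF F] by blast
    then obtain z n where z: "Z = z ` {i::nat. i < n}"
      using finite_imp_nat_seg_image_inj_on[OF Z(2)] by metis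
    then have n: "0 < n" using False Z by auto
    have zC: "z i \<in> C" if "i < n" for i using z Z that by blast
    define comb where "comb x = (\<Sum>i<n. x i *\<^sub>R z i)" for x :: "nat \<Rightarrow> real"
    have "\<exists>x\<in>nat_simplex n. \<forall>i<n. x \<in> comb -` G (z i)"
    proof (rule kkm_nat_simplex[OF n])
      have coord: "continuous_on S (\<lambda>x. x j)" for j :: nat and S :: "(nat \<Rightarrow> real) set"
        by (rule continuous_on_subset[OF continuous_on_product_coordinates]) simp
      have "continuous_on UNIV comb"
        unfolding comb_def by (intro continuous_intros coord)
      then show "closed (comb -` G (z i))" if "i < n" for i
        using closed'[OF zC[OF that]] by (simp add: continuous_on_closed_vimage)
      fix x assume x: "x \<in> nat_simplex n"
      define I where "I = {i. i < n \<and> 0 < x i}"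
      have I: "x i = 0" if "i \<in> {..<n} - I" for i
        using that x by (auto simp: I_def nat_simplex_def less_le)
      have "comb x = (\<Sum>i\<in>I. x i *\<^sub>R z i)"
        unfolding comb_def by (rule sum.mono_neutral_right) (use I in \<open>auto simp: I_def\<close>)
      moreover have "\<exists>i\<in>I. (\<Sum>i\<in>I. x i *\<^sub>R z i) \<in> G (z i)"
      proof (rule cover)
        have "sum x {..<n} = sum x I"
          by (rule sum.mono_neutral_right) (use I in \<open>auto simp: I_def\<close>)
        then show "sum x I = 1" using x by (simp add: nat_simplex_def)
      qed (auto simp: I_def zC)
      ultimately show "\<exists>i<n. 0 < x i \<and> x \<in> comb -` G (z i)"
        by (auto simp: I_def)
    qed
    then obtain x where x: "x \<in> nat_simplex n" "\<And>i. i < n \<Longrightarrow> comb x \<in> G (z i)" by blast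
    have "comb x \<in> C"
      unfolding comb_def using x(1) zC
      by (intro convex_sum[OF _ C(2)]) (auto simp: nat_simplex_def)
    then show ?thesis using x(2) z Z by blast
  qed
  then have "C \<inter> \<Inter>(G ` C) \<noteq> {}"
    using C(1) closed unfolding compactin_fip by (auto simp: top)
  then show ?thesis by blast
qed

section \<open>Semicontinuous functionals\<close>

lemma upper_semicontinuous_add:
  assumes h: "upper_semicontinuous T h" and k: "upper_semicontinuous T k"
  shows "upper_semicontinuous T (\<lambda>x. h x + k x)"
  unfolding upper_semicontinuous_def
proof
  fix c
  have "\<exists>r. h x < r \<and> k x < c - r" if "h x + k x < c" for x
    using that dense[of "h x" "c - k x"] by (auto simp: algebra_simps)
  then have "{x \<in> topspace T. h x + k x < c}
      = (\<Union>r. {x \<in> topspace T. h x < r} \<inter> {x \<in> topspace T. k x < c - r})"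
    by fastforce
  also have "openin T \<dots>"
    using h k unfolding upper_semicontinuous_def by blast
  finally show "openin T {x \<in> topspace T. h x + k x < c}" .
qed

lemma upper_semicontinuous_compose:
  assumes \<phi>: "continuous_map S T \<phi>" and h: "upper_semicontinuous T h"
  shows "upper_semicontinuous S (\<lambda>x. h (\<phi> x))"
  unfolding upper_semicontinuous_def
proof
  fix c
  have "openin S {x \<in> topspace S. \<phi> x \<in> {y \<in> topspace T. h y < c}}"
    using \<phi> h unfolding upper_semicontinuous_def by (blast intro: openin_continuous_map_preimage)
  also have "{x \<in> topspace S. \<phi> x \<in> {y \<in> topspace T. h y < c}} = {x \<in> topspace S. h (\<phi> x) < c}"
    using continuous_map_image_subset_topspace[OF \<phi>] by auto
  finally show "openin S {x \<in> topspace S. h (\<phi> x) < c}" .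
qed

lemma upper_semicontinuous_uminus:
  assumes "lower_semicontinuous T h"
  shows "upper_semicontinuous T (\<lambda>x. - h x)"
proof -
  have "openin T {x \<in> topspace T. - c < h x}" for c
    using assms unfolding lower_semicontinuous_def by blast
  then show ?thesis by (simp add: upper_semicontinuous_def minus_less_iff)
qed

lemma upper_semicontinuous_closedin:
  assumes "upper_semicontinuous T h" and top: "topspace T = UNIV"
  shows "closedin T {x. c \<le> h x}"
proof -
  have "openin T {x. h x < c}" using assms by (simp add: upper_semicontinuous_def)
  moreover have "topspace T - {x. c \<le> h x} = {x. h x < c}" using top by auto
  ultimately show ?thesis by (simp add: closedin_def top)
qed

lemma weakly_usc_functional:
  fixes f :: "'a::real_normed_vector \<Rightarrow>\<^sub>L real"
  shows "upper_semicontinuous weak_topology (\<lambda>x. f x - r)"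
  unfolding upper_semicontinuous_def
proof
  fix c
  have "{x \<in> topspace weak_topology. f x - r < c} = blinfun_apply f -` {..<c + r}" by auto
  then show "openin weak_topology {x \<in> topspace weak_topology. f x - r < c}"
    by (simp only: openin_weak_vimage open_lessThan)
qed

section \<open>The functional B\<close>

text \<open>
  The two conditions on the product are restricted to slices. For fixed \<open>l\<close> (with \<open>m = l\<close>) the first one reads
  that \<open>B u l\<close> is lower semicontinuous in \<open>u\<close>, and the second one that \<open>- B u l\<close> is concave in \<open>u\<close>. For fixed
  \<open>u\<close> (with \<open>v = u\<close>) they give upper semicontinuity and concavity in \<open>l\<close>. Weak semicontinuity implies
  semicontinuity in norm.
\<close>

lemma cond_B2_imp_B1:
  fixes B :: "'a::real_normed_vector \<Rightarrow> 'b::real_normed_vector \<Rightarrow> real"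
  assumes "cond_B2 B"
  shows "cond_B1 B"
proof -
  have lsc: "open {z. c < 2 * B (fst z) m - B (fst z) (snd z)}" for c m
  proof -
    have "lower_semicontinuous weak_topology (\<lambda>(u, l). 2 * B u m - B u l)"
      using assms unfolding cond_B2_def by blast
    then have "openin weak_topology {z. c < 2 * B (fst z) m - B (fst z) (snd z)}"
      by (simp add: lower_semicontinuous_def case_prod_unfold)
    then show ?thesis by (rule weakly_open_imp_open)
  qed
  have conc: "s * (2 * B v l - B u l) + t * (2 * B v l' - B u' l')
      \<le> 2 * B v (s *\<^sub>R l + t *\<^sub>R l') - B (s *\<^sub>R u + t *\<^sub>R u') (s *\<^sub>R l + t *\<^sub>R l')"
    if "0 \<le> s" "0 \<le> t" "s + t = 1" for u u' l l' v and s t :: real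
  proof -
    have "concave_on UNIV (\<lambda>(u, l). 2 * B v l - B u l)"
      using assms by (simp add: cond_B2_def)
    then have "\<forall>x y. \<forall>s\<ge>0. \<forall>t\<ge>0. s + t = 1 \<longrightarrow>
        s * (2 * B v (snd x) - B (fst x) (snd x)) + t * (2 * B v (snd y) - B (fst y) (snd y))
        \<le> 2 * B v (s *\<^sub>R snd x + t *\<^sub>R snd y) - B (s *\<^sub>R fst x + t *\<^sub>R fst y) (s *\<^sub>R snd x + t *\<^sub>R snd y)"
      by (simp add: concave_on_iff case_prod_unfold)
    from this[rule_format, of s t "(u, l)" "(u', l')"] show ?thesis using that by simp
  qed
  show ?thesis
    unfolding cond_B1_def
  proof (intro conjI allI)
    fix l :: 'b
    show "convex_on UNIV (\<lambda>u. B u l)"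
      unfolding convex_on_def
    proof (intro conjI ballI allI impI)
      fix x y :: 'a and s t :: real
      assume st: "0 \<le> s" "0 \<le> t" "s + t = 1"
      have l: "s *\<^sub>R l + t *\<^sub>R l = l" using st by (simp flip: scaleR_add_left)
      have r: "s * r + t * r = r" for r :: real using st by (simp flip: distrib_right)
      show "B (s *\<^sub>R x + t *\<^sub>R y) l \<le> s * B x l + t * B y l"
        using conc[OF st, of x l x l y] conc[OF st, of x l y l x] r[of "B x l"] r[of "2 * B x l"]
        by (simp add: l algebra_simps)
    qed simp
    show "lower_semicontinuous euclidean (\<lambda>u. B u l)"
      unfolding lower_semicontinuous_def
    proof
      fix c
      have "open ((\<lambda>u. (u, l)) -` {z. c < 2 * B (fst z) l - B (fst z) (snd z)})"
        by (intro open_vimage lsc continuous_intros)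
      also have "(\<lambda>u. (u, l)) -` {z. c < 2 * B (fst z) l - B (fst z) (snd z)} = {u. c < B u l}" by auto
      finally show "openin euclidean {u \<in> topspace euclidean. c < B u l}" by simp
    qed
  next
    fix u :: 'a
    show "concave_on UNIV (\<lambda>l. B u l)"
      unfolding concave_on_iff
    proof (intro conjI ballI allI impI)
      fix l l' :: 'b and s t :: real
      assume st: "0 \<le> s" "0 \<le> t" "s + t = 1"
      have u: "s *\<^sub>R u + t *\<^sub>R u = u" using st by (simp flip: scaleR_add_left)
      show "s * B u l + t * B u l' \<le> B u (s *\<^sub>R l + t *\<^sub>R l')"
        using conc[OF st, of u l u l' u] by (simp add: u)
    qed simp
    show "upper_semicontinuous euclidean (\<lambda>l. B u l)"
      unfolding upper_semicontinuous_def
    proof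
      fix c
      have "open ((\<lambda>l. (u, l)) -` {z. 2 * B u 0 - c < 2 * B (fst z) 0 - B (fst z) (snd z)})"
        by (intro open_vimage lsc continuous_intros)
      also have "(\<lambda>l. (u, l)) -` {z. 2 * B u 0 - c < 2 * B (fst z) 0 - B (fst z) (snd z)} = {l. B u l < c}"
        by auto
      finally show "openin euclidean {l \<in> topspace euclidean. B u l < c}" by simp
    qed
  qed
qed

section \<open>The functionals chi and psi\<close>

text \<open>
  The function \<open>c u v\<close> takes the place of \<open>chi u (v - u)\<close> in the equilibrium problem. The first
  and third condition are those of the KKM principle; the weighted sum is used instead of a pointwise
  condition because it can be added to the corresponding sums for the other terms of the problem. The
  second condition splits a solution of the coupled problem into its two inequalities, and the last
  condition allows returning to \<open>chi\<close>; there \<open>h\<close> stands for the convex remainder of the problem in the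
  variable \<open>v\<close>.
\<close>

definition weak_substitute ::
    "('a::real_normed_vector \<Rightarrow> 'a \<Rightarrow> real) \<Rightarrow> ('a \<Rightarrow> 'a \<Rightarrow> real) \<Rightarrow> bool"
  where "weak_substitute chi c \<longleftrightarrow>
    (\<forall>v. upper_semicontinuous weak_topology (\<lambda>u. c u v)) \<and>
    (\<forall>u. c u u = 0) \<and>
    (\<forall>I t v. finite I \<longrightarrow> (\<forall>i\<in>I. 0 < t i) \<longrightarrow> sum t I = 1 \<longrightarrow>
      0 \<le> (\<Sum>i\<in>I. t i * c (\<Sum>j\<in>I. t j *\<^sub>R v j) (v (i :: nat)))) \<and>
    (\<forall>u C h. convex C \<longrightarrow> u \<in> C \<longrightarrow> convex_on UNIV h \<longrightarrow> h u = 0 \<longrightarrow>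
      (\<forall>v\<in>C. 0 \<le> c u v + h v) \<longrightarrow> (\<forall>v\<in>C. 0 \<le> chi u (v - u) + h v))"

lemma weak_substitute_mean_nonneg:
  assumes "weak_substitute chi c" and "finite I" and "\<And>i. i \<in> I \<Longrightarrow> 0 < t i" and "sum t I = 1"
  shows "0 \<le> (\<Sum>i\<in>I. t i * c (\<Sum>j\<in>I. t j *\<^sub>R v j) (v (i :: nat)))"
proof -
  have "\<forall>I t v. finite I \<longrightarrow> (\<forall>i\<in>I. 0 < t i) \<longrightarrow> sum t I = 1 \<longrightarrow>
      0 \<le> (\<Sum>i\<in>I. t i * c (\<Sum>j\<in>I. t j *\<^sub>R v j) (v (i :: nat)))"
    using assms(1) unfolding weak_substitute_def by (elim conjE)
  from this[rule_format, of I t v] show ?thesis using assms(2-4) by simp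
qed

lemma weak_substitute_return:
  assumes "weak_substitute chi c" and "convex C" "u \<in> C" "convex_on UNIV h" "h u = 0"
    and "\<And>v. v \<in> C \<Longrightarrow> 0 \<le> c u v + h v" and "v \<in> C"
  shows "0 \<le> chi u (v - u) + h v"
proof -
  have "\<forall>u C h. convex C \<longrightarrow> u \<in> C \<longrightarrow> convex_on UNIV h \<longrightarrow> h u = 0 \<longrightarrow>
      (\<forall>v\<in>C. 0 \<le> c u v + h v) \<longrightarrow> (\<forall>v\<in>C. 0 \<le> chi u (v - u) + h v)"
    using assms(1) unfolding weak_substitute_def by (elim conjE)
  from this[rule_format, of C u h v] show ?thesis using assms(2-7) by simp
qed

lemma weighted_differences_vanish:
  fixes v :: "'i \<Rightarrow> 'a::real_vector"
  assumes "sum t I = 1"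
  shows "(\<Sum>i\<in>I. t i *\<^sub>R (v i - (\<Sum>j\<in>I. t j *\<^sub>R v j))) = 0"
proof -
  have "(\<Sum>i\<in>I. t i *\<^sub>R (v i - w)) = (\<Sum>i\<in>I. t i *\<^sub>R v i) - sum t I *\<^sub>R w" for w
    by (simp add: scaleR_diff_right sum_subtractf scaleR_left.sum)
  then show ?thesis using assms by simp
qed

lemma cond_X1_weak_substitute:
  assumes X: "cond_X1 chi"
  shows "weak_substitute chi (\<lambda>u v. chi u (v - u))"
  unfolding weak_substitute_def
proof (intro conjI allI impI ballI)
  fix I :: "nat set" and t :: "nat \<Rightarrow> real" and v :: "nat \<Rightarrow> 'a"
  assume I: "finite I" "\<forall>i\<in>I. 0 < t i" "sum t I = 1"
  define u where "u = (\<Sum>j\<in>I. t j *\<^sub>R v j)"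
  have ne: "I \<noteq> {}" using I(3) by auto
  have "convex_on UNIV (chi u)" "chi u 0 = 0" using X by (auto simp: cond_X1_def)
  then show "0 \<le> (\<Sum>i\<in>I. t i * chi u (v i - u))"
    using convex_on_sum[OF I(1) ne, of UNIV "chi u" t "\<lambda>i. v i - u"] I
      weighted_differences_vanish[OF I(3), of v]
    by (simp add: u_def less_imp_le)
qed (use X in \<open>auto simp: cond_X1_def\<close>)

text \<open>
  Minty's argument: test with the point \<open>u + t (v - u)\<close>, divide by \<open>t\<close> using homogeneity of \<open>chi\<close> and
  convexity of \<open>h\<close>, and let \<open>t\<close> tend to 0.
\<close>

lemma monotone_linearization:
  assumes X: "cond_X2 chi" and C: "convex C" "u \<in> C"
    and h: "convex_on UNIV h" "h u = 0" and dual: "\<And>v. v \<in> C \<Longrightarrow> 0 \<le> chi v (v - u) + h v"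
    and v: "v \<in> C"
  shows "0 \<le> chi u (v - u) + h v"
proof -
  have "((\<lambda>t. chi (u + t *\<^sub>R (v - u)) (v - u) + h v) \<longlongrightarrow> chi u (v - u) + h v) (at_right 0)"
    using X by (intro tendsto_add tendsto_const) (simp add: cond_X2_def)
  moreover have "\<forall>\<^sub>F t in at_right 0. 0 \<le> chi (u + t *\<^sub>R (v - u)) (v - u) + h v"
  proof -
    have "0 \<le> chi (u + t *\<^sub>R (v - u)) (v - u) + h v" if t: "0 < t" "t < 1" for t :: real
    proof -
      define x where "x = u + t *\<^sub>R (v - u)"
      have x: "x = (1 - t) *\<^sub>R u + t *\<^sub>R v" by (simp add: x_def algebra_simps)
      have "x \<in> C" unfolding x using C v t by (intro convexD) auto
      have "h x \<le> (1 - t) * h u + t * h v"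
        unfolding x using t by (intro convex_onD[OF h(1)]) auto
      moreover have "chi x (x - u) = t * chi x (v - u)"
        using X t by (simp add: x_def cond_X2_def positive_homogeneous_def)
      ultimately have "0 \<le> t * (chi x (v - u) + h v)"
        using dual[OF \<open>x \<in> C\<close>] h(2) by (simp add: distrib_left)
      then show ?thesis using t by (simp add: x_def zero_le_mult_iff)
    qed
    then show ?thesis
      unfolding eventually_at_right_field by (intro exI[of _ 1]) simp
  qed
  ultimately show ?thesis
    by (rule tendsto_lowerbound) simp
qed

text \<open>
  At a convex combination \<open>u\<close> of the points \<open>v i\<close>, monotonicity bounds \<open>chi (v i) (v i - u)\<close> below by
  \<open>- chi u (u - v i)\<close>. The mean of the latter is nonnegative by concavity, since the mean of
  \<open>u - v i\<close> is 0.
\<close>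

lemma cond_X2_weak_substitute:
  assumes X: "cond_X2 chi"
  shows "weak_substitute chi (\<lambda>u v. chi v (v - u))"
  unfolding weak_substitute_def
proof (intro conjI allI impI ballI)
  fix v
  have conc: "concave_on UNIV (chi v)" and usc: "upper_semicontinuous euclidean (chi v)"
    using X by (auto simp: cond_X2_def)
  show "upper_semicontinuous weak_topology (\<lambda>u. chi v (v - u))"
  proof (rule concave_usc_imp_weakly_usc)
    show "upper_semicontinuous euclidean (\<lambda>u. chi v (v - u))"
      by (rule upper_semicontinuous_compose[OF _ usc]) (simp add: continuous_intros)
    show "concave_on UNIV (\<lambda>u. chi v (v - u))"
      unfolding concave_on_iff
    proof (intro conjI ballI allI impI)
      fix x y and s t :: real assume st: "0 \<le> s" "0 \<le> t" "s + t = 1"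
      have "v - (s *\<^sub>R x + t *\<^sub>R y) = (s + t) *\<^sub>R v - (s *\<^sub>R x + t *\<^sub>R y)" using st by simp
      also have "\<dots> = s *\<^sub>R (v - x) + t *\<^sub>R (v - y)" by (simp add: algebra_simps)
      finally show "s * chi v (v - x) + t * chi v (v - y) \<le> chi v (v - (s *\<^sub>R x + t *\<^sub>R y))"
        using conc st by (simp add: concave_on_iff)
    qed simp
  qed
next
  fix I :: "nat set" and t :: "nat \<Rightarrow> real" and v :: "nat \<Rightarrow> 'a"
  assume I: "finite I" "\<forall>i\<in>I. 0 < t i" "sum t I = 1"
  define u where "u = (\<Sum>j\<in>I. t j *\<^sub>R v j)"
  have ne: "I \<noteq> {}" using I(3) by auto
  have "(\<Sum>i\<in>I. t i *\<^sub>R (u - v i)) = - (\<Sum>i\<in>I. t i *\<^sub>R (v i - u))"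
    by (simp add: scaleR_diff_right sum_subtractf)
  also have "\<dots> = 0" using weighted_differences_vanish[OF I(3), of v] by (simp add: u_def)
  finally have bary: "(\<Sum>i\<in>I. t i *\<^sub>R (u - v i)) = 0" .
  have "concave_on UNIV (chi u)" "chi u 0 = 0" using X by (auto simp: cond_X2_def)
  then have "(\<Sum>i\<in>I. t i * chi u (u - v i)) \<le> 0"
    using concave_on_sum[OF I(1) ne, of UNIV "chi u" t "\<lambda>i. u - v i"] I bary
    by (simp add: less_imp_le)
  moreover have "(\<Sum>i\<in>I. t i * - chi u (u - v i)) \<le> (\<Sum>i\<in>I. t i * chi (v i) (v i - u))"
  proof (intro sum_mono mult_left_mono)
    fix i assume "i \<in> I"
    have "0 \<le> chi u (u - v i) + chi (v i) (v i - u)" using X by (simp add: cond_X2_def)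
    then show "- chi u (u - v i) \<le> chi (v i) (v i - u)" by simp
    show "0 \<le> t i" using I(2) \<open>i \<in> I\<close> by (simp add: less_imp_le)
  qed
  ultimately show "0 \<le> (\<Sum>i\<in>I. t i * chi (v i) (v i - u))"
    by (simp add: sum_negf)
next
  fix u C h v
  assume "convex C" "u \<in> C" "convex_on UNIV h" "h u = 0" "\<forall>v\<in>C. 0 \<le> chi v (v - u) + h v" "v \<in> C"
  then show "0 \<le> chi u (v - u) + h v"
    by (intro monotone_linearization[OF X]) auto
qed (use X in \<open>simp add: cond_X2_def\<close>)

lemma weak_substitute_exists: "cond_X1 chi \<or> cond_X2 chi \<Longrightarrow> \<exists>c. weak_substitute chi c"
  using cond_X1_weak_substitute cond_X2_weak_substitute by blast

lemma chi_subhomogeneous: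
  assumes "cond_X1 chi \<or> cond_X2 chi" and t: "0 < t" "t \<le> 1"
  shows "chi u (t *\<^sub>R z) \<le> t * chi u z"
  using assms(1)
proof
  assume "cond_X1 chi"
  then have "convex_on UNIV (chi u)" "chi u 0 = 0" by (auto simp: cond_X1_def)
  then show ?thesis using convex_onD[of UNIV "chi u" t 0 z] t by simp
next
  assume "cond_X2 chi"
  then show ?thesis using t by (simp add: cond_X2_def positive_homogeneous_def)
qed

section \<open>Solutions on bounded sets\<close>

lemma open_weak_prod_imp_open:
  assumes "openin (prod_topology weak_topology weak_topology) W"
  shows "open W"
  unfolding open_prod_def
proof
  fix z assume "z \<in> W"
  then obtain U V where "openin weak_topology U" "openin weak_topology V"
    "fst z \<in> U" "snd z \<in> V" "U \<times> V \<subseteq> W"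
    using assms unfolding openin_prod_topology_alt by (metis prod.collapse)
  then show "\<exists>A B. open A \<and> open B \<and> z \<in> A \<times> B \<and> A \<times> B \<subseteq> W"
    using weakly_open_imp_open by (metis mem_Times_iff)
qed

lemma affine_convex_on:
  fixes f :: "'a::real_normed_vector \<Rightarrow>\<^sub>L real"
  assumes "convex_on UNIV h"
  shows "convex_on UNIV (\<lambda>v. h v - r - f (v - u))"
  unfolding convex_on_def
proof (intro conjI ballI allI impI)
  fix x y and s t :: real assume st: "0 \<le> s" "0 \<le> t" "s + t = 1"
  have "h (s *\<^sub>R x + t *\<^sub>R y) \<le> s * h x + t * h y"
    using assms st by (simp add: convex_on_def)
  moreover have "s * a + t * a = a" for a :: real using st by (simp flip: distrib_right)
  note this[of r] this[of "f u"]
  ultimately show "h (s *\<^sub>R x + t *\<^sub>R y) - r - f (s *\<^sub>R x + t *\<^sub>R y - u)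
      \<le> s * (h x - r - f (x - u)) + t * (h y - r - f (y - u))"
    by (simp add: blinfun.diff_right blinfun.add_right blinfun.scaleR_right algebra_simps)
qed simp

text \<open>
  The KKM principle applies to the equilibrium function \<open>F\<close> with \<open>chi\<close> and \<open>psi\<close> replaced by their
  substitutes. At a convex combination of the \<open>z i\<close>, the weighted mean of \<open>F w (z i)\<close> is nonnegative: the
  substitutes and the convexity of \<open>B\<close> contribute terms whose lower bounds sum to zero, and the linear
  terms cancel. So not all values \<open>F w (z i)\<close> are negative. The two inequalities are separated
  before each of them returns to \<open>chi\<close> or \<open>psi\<close>.
\<close>

lemma bounded_equilibrium:
  fixes K :: "'a::real_normed_vector set" and L :: "'b::real_normed_vector set"
    and f :: "'a \<Rightarrow>\<^sub>L real" and g :: "'b \<Rightarrow>\<^sub>L real" and B :: "'a \<Rightarrow> 'b \<Rightarrow> real"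
  assumes refl: "reflexive_space TYPE('a)" "reflexive_space TYPE('b)"
    and K: "convex K" "closed K" "bounded K" "K \<noteq> {}"
    and L: "convex L" "closed L" "bounded L" "L \<noteq> {}"
    and c: "weak_substitute chi c" and d: "weak_substitute psi d" and B: "cond_B1 B"
  obtains u l where "u \<in> K" "l \<in> L"
    "\<And>v. v \<in> K \<Longrightarrow> 0 \<le> chi u (v - u) + (B v l - B u l - f (v - u))"
    "\<And>m. m \<in> L \<Longrightarrow> 0 \<le> psi l (m - l) + (- B u m - (- B u l) - g (m - l))"
proof -
  define F where "F w z = c (fst w) (fst z) + d (snd w) (snd z)
      + B (fst z) (snd w) + - B (fst w) (snd z)
      + (f (fst w) - f (fst z)) + (g (snd w) - g (snd z))" for w z
  let ?T = "prod_topology weak_topology weak_topology :: ('a \<times> 'b) topology"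
  have Bcvx: "convex_on UNIV (\<lambda>u. B u l)" and Bconc: "convex_on UNIV (\<lambda>l. - B u l)" for u l
    using B by (auto simp: cond_B1_def concave_on_def)
  have Busc: "upper_semicontinuous weak_topology (\<lambda>l. B u l)" for u
    using B by (auto simp: cond_B1_def intro: concave_usc_imp_weakly_usc)
  have Blsc: "upper_semicontinuous weak_topology (\<lambda>u. - B u l)" for l
  proof (rule concave_usc_imp_weakly_usc)
    show "concave_on UNIV (\<lambda>u. - B u l)" using Bcvx by (simp add: concave_on_def)
    show "upper_semicontinuous euclidean (\<lambda>u. - B u l)"
      by (rule upper_semicontinuous_uminus) (use B in \<open>simp add: cond_B1_def\<close>)
  qed
  have "\<exists>w\<in>K \<times> L. \<forall>z\<in>K \<times> L. w \<in> {w. 0 \<le> F w z}"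
  proof (rule kkm[of ?T])
    show "open W" if "openin ?T W" for W using that by (rule open_weak_prod_imp_open)
    show "topspace ?T = UNIV" by simp
    show "compactin ?T (K \<times> L)"
      using bounded_closed_convex_imp_weakly_compact[OF refl(1) K(1-3)]
        bounded_closed_convex_imp_weakly_compact[OF refl(2) L(1-3)] by (simp add: compactin_Times)
    show "convex (K \<times> L)" using K L by (simp add: convex_Times)
    show "K \<times> L \<noteq> {}" using K L by simp
    have "upper_semicontinuous ?T (\<lambda>w. F w z)" for z
      unfolding F_def using c d
      by (intro upper_semicontinuous_add upper_semicontinuous_compose[OF continuous_map_fst]
          upper_semicontinuous_compose[OF continuous_map_snd] Busc Blsc weakly_usc_functional)
        (auto simp: weak_substitute_def)
    then show "closedin ?T {w. 0 \<le> F w z}" for z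
      by (rule upper_semicontinuous_closedin) simp
    fix I :: "nat set" and z :: "nat \<Rightarrow> 'a \<times> 'b" and t :: "nat \<Rightarrow> real"
    assume I: "finite I" and t: "\<And>i. i \<in> I \<Longrightarrow> 0 < t i" and sum: "sum t I = 1"
    have ne: "I \<noteq> {}" using sum by auto
    define w where "w = (\<Sum>i\<in>I. t i *\<^sub>R z i)"
    have fst_w: "fst w = (\<Sum>i\<in>I. t i *\<^sub>R fst (z i))" and snd_w: "snd w = (\<Sum>i\<in>I. t i *\<^sub>R snd (z i))"
      by (simp_all add: w_def fst_sum snd_sum)
    have weights: "(\<Sum>i\<in>I. t i * r) = r" for r :: real
      using sum_distrib_right[of t I r] sum by simp
    have "0 \<le> (\<Sum>i\<in>I. t i * c (fst w) (fst (z i)))"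
      unfolding fst_w by (rule weak_substitute_mean_nonneg[OF c I t sum])
    moreover have "0 \<le> (\<Sum>i\<in>I. t i * d (snd w) (snd (z i)))"
      unfolding snd_w by (rule weak_substitute_mean_nonneg[OF d I t sum])
    moreover have "B (fst w) (snd w) \<le> (\<Sum>i\<in>I. t i * B (fst (z i)) (snd w))"
      unfolding fst_w using t by (intro convex_on_sum[OF I ne Bcvx sum]) (auto simp: less_imp_le)
    moreover have "- B (fst w) (snd w) \<le> (\<Sum>i\<in>I. t i * - B (fst w) (snd (z i)))"
      using t convex_on_sum[OF I ne Bconc[of "fst w"] sum, of "\<lambda>i. snd (z i)"]
      by (simp add: snd_w less_imp_le)
    moreover have "(\<Sum>i\<in>I. t i * (f (fst w) - f (fst (z i)))) = 0"
    proof -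
      have "f (fst w) = (\<Sum>i\<in>I. t i * f (fst (z i)))"
        by (simp add: fst_w blinfun.sum_right blinfun.scaleR_right)
      then show ?thesis by (simp add: right_diff_distrib sum_subtractf weights)
    qed
    moreover have "(\<Sum>i\<in>I. t i * (g (snd w) - g (snd (z i)))) = 0"
    proof -
      have "g (snd w) = (\<Sum>i\<in>I. t i * g (snd (z i)))"
        by (simp add: snd_w blinfun.sum_right blinfun.scaleR_right)
      then show ?thesis by (simp add: right_diff_distrib sum_subtractf weights)
    qed
    ultimately have nonneg: "0 \<le> (\<Sum>i\<in>I. t i * F w (z i))"
      unfolding F_def distrib_left sum.distrib by linarith
    show "\<exists>i\<in>I. (\<Sum>i\<in>I. t i *\<^sub>R z i) \<in> {w. 0 \<le> F w (z i)}"
    proof (rule ccontr)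
      assume "\<not> ?thesis"
      then have "F w (z i) < 0" if "i \<in> I" for i
        using that by (auto simp: w_def not_le)
      then have "(\<Sum>i\<in>I. t i * F w (z i)) < (\<Sum>i\<in>I. 0)"
        using t by (intro sum_strict_mono I ne) (simp add: mult_pos_neg)
      then show False using nonneg by simp
    qed
  qed
  then obtain u l where ul: "u \<in> K" "l \<in> L" and F: "\<And>v m. v \<in> K \<Longrightarrow> m \<in> L \<Longrightarrow> 0 \<le> F (u, l) (v, m)"
    by fastforce
  have diag: "c u u = 0" "d l l = 0" using c d by (auto simp: weak_substitute_def)
  show thesis
  proof (rule that[OF ul])
    have sub_u: "0 \<le> c u v + (B v l - B u l - f (v - u))" if "v \<in> K" for v
      using F[OF that ul(2)] diag by (simp add: F_def blinfun.diff_right algebra_simps)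
    show "0 \<le> chi u (v - u) + (B v l - B u l - f (v - u))" if "v \<in> K" for v
      by (rule weak_substitute_return[OF c K(1) ul(1) affine_convex_on[OF Bcvx] _ sub_u that]) auto
    have sub_l: "0 \<le> d l m + (- B u m - (- B u l) - g (m - l))" if "m \<in> L" for m
      using F[OF ul(1) that] diag by (simp add: F_def blinfun.diff_right algebra_simps)
    show "0 \<le> psi l (m - l) + (- B u m - (- B u l) - g (m - l))" if "m \<in> L" for m
      by (rule weak_substitute_return[OF d L(1) ul(2) affine_convex_on[OF Bconc] _ sub_l that]) auto
  qed
qed

section \<open>From a ball to the whole set\<close>

text \<open>
  The bound \<open>norm u < R\<close> leaves room for a short step from \<open>u\<close> towards any \<open>v\<close> in \<open>K\<close>. At the
  resulting point the sum of the two terms is at most \<open>t\<close> times the sum at \<open>v\<close>, by convexity of \<open>h\<close> and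
  \<open>chi_subhomogeneous\<close>.
\<close>

lemma interior_solution_is_global:
  fixes K :: "'a::real_normed_vector set"
  assumes X: "cond_X1 chi \<or> cond_X2 chi" and K: "convex K" "u \<in> K" and u: "norm u < R"
    and h: "convex_on UNIV h" "h u = 0"
    and loc: "\<And>v. v \<in> K \<inter> cball 0 R \<Longrightarrow> 0 \<le> chi u (v - u) + h v" and v: "v \<in> K"
  shows "0 \<le> chi u (v - u) + h v"
proof -
  define t where "t = min 1 ((R - norm u) / (norm (v - u) + 1))"
  have n: "0 < norm (v - u) + 1" by (simp add: add_nonneg_pos)
  have t: "0 < t" "t \<le> 1" using u n by (auto simp: t_def)
  have "t * norm (v - u) \<le> (R - norm u) / (norm (v - u) + 1) * (norm (v - u) + 1)"
    using t by (intro mult_mono) (auto simp: t_def)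
  then have tn: "t * norm (v - u) \<le> R - norm u" using n by simp
  define x where "x = u + t *\<^sub>R (v - u)"
  have x: "x = (1 - t) *\<^sub>R u + t *\<^sub>R v" by (simp add: x_def algebra_simps)
  have "x \<in> K" unfolding x using K v t by (intro convexD) auto
  moreover have "norm x \<le> R"
    using norm_triangle_ineq[of u "t *\<^sub>R (v - u)"] tn t by (simp add: x_def)
  ultimately have "0 \<le> chi u (t *\<^sub>R (v - u)) + h x" using loc[of x] by (simp add: x_def)
  also have "\<dots> \<le> t * chi u (v - u) + t * h v"
  proof (rule add_mono)
    show "chi u (t *\<^sub>R (v - u)) \<le> t * chi u (v - u)" by (rule chi_subhomogeneous[OF X t])
    show "h x \<le> t * h v"
      using convex_onD[OF h(1), of t u v] t h(2) by (simp add: x)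
  qed
  finally have "0 \<le> t * (chi u (v - u) + h v)" by (simp add: distrib_left)
  then show ?thesis using t(1) by (simp add: zero_le_mult_iff)
qed

section \<open>Coercivity\<close>

text \<open>
  Semicontinuity bounds \<open>h\<close> on a small ball around 0. For \<open>x\<close> outside the ball, concavity on the segment
  from 0 to \<open>x\<close>, which meets the sphere in \<open>t *\<^sub>R x\<close>, extends the bound linearly.
\<close>

lemma concave_usc_linear_growth:
  fixes h :: "'a::real_normed_vector \<Rightarrow> real"
  assumes "concave_on UNIV h" and "upper_semicontinuous euclidean h"
  shows "\<exists>a\<ge>0. \<exists>b\<ge>0. \<forall>x. h x \<le> a + b * norm x"
proof -
  have "open {x. h x < h 0 + 1}" using assms(2) by (simp add: upper_semicontinuous_def)
  then have "\<exists>r>0. cball 0 r \<subseteq> {x. h x < h 0 + 1}"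
    by (rule bspec[OF iffD1[OF open_contains_cball]]) simp
  then obtain r where r: "r > 0" "cball 0 r \<subseteq> {x. h x < h 0 + 1}"
    by blast
  have "h x \<le> (\<bar>h 0\<bar> + 1) + (1 / r) * norm x" for x
  proof (cases "norm x \<le> r")
    case True
    then have "h x < h 0 + 1" using r(2) by auto
    moreover have "0 \<le> (1 / r) * norm x" using r by simp
    ultimately show ?thesis by linarith
  next
    case False
    then have x: "r < norm x" "0 < norm x" using r(1) by linarith+
    define t where "t = r / norm x"
    have t: "0 < t" "t < 1" using x r(1) unfolding t_def by (auto intro: divide_pos_pos)
    have "norm (t *\<^sub>R x) \<le> r" using x r(1) by (auto simp: t_def)
    then have "t *\<^sub>R x \<in> cball 0 r" by (simp only: mem_cball_0)
    then have "h (t *\<^sub>R x) < h 0 + 1" using r(2) by blast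
    moreover have "(1 - t) * h 0 + t * h x \<le> h (t *\<^sub>R x)"
      using concave_onD[OF assms(1), of t 0 x] t by simp
    ultimately have "t * (h x - h 0) \<le> 1" by (simp add: algebra_simps)
    then have "h x - h 0 \<le> 1 / t" using t by (simp add: field_simps)
    also have "1 / t = (1 / r) * norm x" by (simp add: t_def)
    finally show ?thesis by linarith
  qed
  moreover have "0 \<le> \<bar>h 0\<bar> + 1" "0 \<le> 1 / r" using r by auto
  ultimately show ?thesis by blast
qed

lemma functional_bound: "blinfun_apply (f :: 'a::real_normed_vector \<Rightarrow>\<^sub>L real) u \<le> norm f * norm u"
  using norm_blinfun[of f u] by simp

text \<open>
  The terms from \<open>B\<close>, \<open>f\<close> and \<open>g\<close> grow at most linearly, with a total slope less than \<open>M\<close> once the norm is at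
  least 1, while (C1) pushes the remaining terms below \<open>- M\<close> times the norm.
\<close>

lemma coercive_C1:
  fixes f :: "'a::real_normed_vector \<Rightarrow>\<^sub>L real" and g :: "'b::real_normed_vector \<Rightarrow>\<^sub>L real"
  assumes C1: "cond_C1 chi psi" and B: "cond_B1 B"
  shows "\<exists>R>0. \<forall>u l. R \<le> norm (u, l) \<longrightarrow>
    chi u (- u) + psi l (- l) + B 0 l - B u 0 + f u + g l < 0"
proof -
  obtain a b where ab: "a \<ge> 0" "b \<ge> 0" "\<And>l. B 0 l \<le> a + b * norm l"
    using concave_usc_linear_growth[of "B 0"] B by (auto simp: cond_B1_def)
  have "concave_on UNIV (\<lambda>u. - B u 0)" using B by (simp add: cond_B1_def concave_on_def)
  moreover have "upper_semicontinuous euclidean (\<lambda>u. - B u 0)"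
    by (rule upper_semicontinuous_uminus) (use B in \<open>simp add: cond_B1_def\<close>)
  ultimately obtain a' b' where ab': "a' \<ge> 0" "b' \<ge> 0" "\<And>u. - B u 0 \<le> a' + b' * norm u"
    using concave_usc_linear_growth[of "\<lambda>u. - B u 0"] by blast
  define M where "M = a + b + a' + b' + norm f + norm g + 1"
  have "\<forall>\<^sub>F z in at_infinity.
      (case z of (u, l) \<Rightarrow> (chi u (- u) + psi l (- l)) / sqrt ((norm u)\<^sup>2 + (norm l)\<^sup>2)) \<le> - M"
    using C1 unfolding cond_C1_def filterlim_at_bot by blast
  then obtain R where R: "\<And>u l. R \<le> norm (u, l) \<Longrightarrow> (chi u (- u) + psi l (- l)) / norm (u, l) \<le> - M"
    unfolding eventually_at_infinity norm_Pair by (metis (no_types, lifting) case_prod_conv norm_Pair)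
  have "chi u (- u) + psi l (- l) + B 0 l - B u 0 + f u + g l < 0" if ul: "max R 1 \<le> norm (u, l)" for u l
  proof -
    define N where "N = norm (u, l)"
    have N: "1 \<le> N" "norm u \<le> N" "norm l \<le> N"
      using ul norm_fst_le[of u l] norm_snd_le[of l u] by (auto simp: N_def)
    have "(chi u (- u) + psi l (- l)) / N \<le> - M"
      using R[of u l] ul by (simp add: N_def)
    then have "chi u (- u) + psi l (- l) \<le> - M * N"
      using N(1) by (simp add: pos_divide_le_eq)
    moreover have "b * norm l \<le> b * N" "b' * norm u \<le> b' * N" "norm f * norm u \<le> norm f * N"
      "norm g * norm l \<le> norm g * N"
      using N ab ab' by (auto intro: mult_left_mono)
    moreover have "a \<le> a * N" "a' \<le> a' * N" using mult_left_mono[OF N(1)] ab ab' by fastforce+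
    moreover have "M * N = a * N + b * N + a' * N + b' * N + norm f * N + norm g * N + N"
      by (simp add: M_def algebra_simps)
    ultimately show ?thesis
      using ab(3)[of l] ab'(3)[of u] functional_bound[of f u] functional_bound[of g l] N(1) by linarith
  qed
  then show ?thesis by (intro exI[of _ "max R 1"]) auto
qed

text \<open>
  For norms at least 1 all terms except those from \<open>B\<close> are bounded by a multiple of the power
  \<open>max p q\<close> of the norm, with a total factor less than \<open>M\<close>. This uses \<open>max p q \<ge> 1\<close> for the linear terms.
\<close>

lemma coercive_C2:
  fixes f :: "'a::real_normed_vector \<Rightarrow>\<^sub>L real" and g :: "'b::real_normed_vector \<Rightarrow>\<^sub>L real"
  assumes C2: "cond_C2 B chi psi"
  shows "\<exists>R>0. \<forall>u l. R \<le> norm (u, l) \<longrightarrow>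
    chi u (- u) + psi l (- l) + B 0 l - B u 0 + f u + g l < 0"
proof -
  obtain c d p q where cd: "0 < c" "0 < d" and pq: "1 \<le> p" "1 \<le> q"
    and chi: "\<And>u. chi u (- u) \<le> c * norm u powr p" and psi: "\<And>l. psi l (- l) \<le> d * norm l powr q"
    and lim: "filterlim (\<lambda>(u, l). (B 0 l - B u 0) / sqrt ((norm u)\<^sup>2 + (norm l)\<^sup>2) powr max p q)
        at_bot at_infinity"
    using C2 unfolding cond_C2_def by blast
  define M where "M = c + d + norm f + norm g + 1"
  have "\<forall>\<^sub>F z in at_infinity.
      (case z of (u, l) \<Rightarrow> (B 0 l - B u 0) / sqrt ((norm u)\<^sup>2 + (norm l)\<^sup>2) powr max p q) \<le> - M"
    using lim unfolding filterlim_at_bot by blast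
  then obtain R where R: "\<And>u l. R \<le> norm (u, l) \<Longrightarrow> (B 0 l - B u 0) / norm (u, l) powr max p q \<le> - M"
    unfolding eventually_at_infinity norm_Pair by (metis (no_types, lifting) case_prod_conv norm_Pair)
  have "chi u (- u) + psi l (- l) + B 0 l - B u 0 + f u + g l < 0" if ul: "max R 1 \<le> norm (u, l)" for u l
  proof -
    define N where "N = norm (u, l)"
    define P where "P = N powr max p q"
    have N: "1 \<le> N" "norm u \<le> N" "norm l \<le> N"
      using ul norm_fst_le[of u l] norm_snd_le[of l u] by (auto simp: N_def)
    have P: "0 < P" "N \<le> P"
      using N(1) powr_mono[of 1 "max p q" N] pq by (auto simp: P_def)
    have "norm u powr p \<le> N powr p" "norm l powr q \<le> N powr q"
      using N pq by (auto intro!: powr_mono2)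
    moreover have "N powr p \<le> P" "N powr q \<le> P"
      using N(1) by (auto simp: P_def intro!: powr_mono)
    ultimately have "c * norm u powr p \<le> c * P" "d * norm l powr q \<le> d * P"
      using cd by (auto intro!: mult_left_mono)
    moreover have "norm f * norm u \<le> norm f * P" "norm g * norm l \<le> norm g * P"
      using N P by (auto intro!: mult_left_mono)
    moreover have "B 0 l - B u 0 \<le> - M * P"
      using R[of u l] ul P(1) by (simp add: N_def P_def divide_le_eq)
    moreover have "M * P = c * P + d * P + norm f * P + norm g * P + P"
      by (simp add: M_def algebra_simps)
    ultimately show ?thesis
      using chi[of u] psi[of l] functional_bound[of f u] functional_bound[of g l] P(1) by linarith
  qed
  then show ?thesis by (intro exI[of _ "max R 1"]) auto
qed

section \<open>Existence of solutions\<close>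

theorem theorem2p1:
  fixes K :: "'a::banach set" and L :: "'b::banach set"
    and f :: "'a \<Rightarrow>\<^sub>L real" and g :: "'b \<Rightarrow>\<^sub>L real"
    and B :: "'a \<Rightarrow> 'b \<Rightarrow> real"
    and chi :: "'a \<Rightarrow> 'a \<Rightarrow> real" and psi :: "'b \<Rightarrow> 'b \<Rightarrow> real"
  assumes "reflexive_space TYPE('a)" and "reflexive_space TYPE('b)"
    and "\<not> bounded K" and "closed K" and "convex K" and "0 \<in> K"
    and "\<not> bounded L" and "closed L" and "convex L" and "0 \<in> L"
    and "cond_X1 chi \<or> cond_X2 chi"
    and "cond_X1 psi \<or> cond_X2 psi"
    and "(cond_C1 chi psi \<and> cond_B1 B) \<or> (cond_C2 B chi psi \<and> (cond_B1 B \<or> cond_B2 B))"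
  shows "\<exists>u\<in>K. \<exists>l\<in>L.
    (\<forall>v\<in>K. B v l - B u l + chi u (v - u) \<ge> blinfun_apply f (v - u)) \<and>
    (\<forall>m\<in>L. B u l - B u m + psi l (m - l) \<ge> blinfun_apply g (m - l))"
proof -
  have B: "cond_B1 B" using assms(13) cond_B2_imp_B1 by blast
  obtain R where R: "0 < R" "\<And>u l. R \<le> norm (u, l) \<Longrightarrow>
      chi u (- u) + psi l (- l) + B 0 l - B u 0 + f u + g l < 0"
    using assms(13) coercive_C1[of chi psi B f g] coercive_C2[of B chi psi f g] by blast
  obtain c where c: "weak_substitute chi c" using weak_substitute_exists[OF assms(11)] by blast
  obtain d where d: "weak_substitute psi d" using weak_substitute_exists[OF assms(12)] by blast
  have KR: "convex (K \<inter> cball 0 R)" "closed (K \<inter> cball 0 R)" "bounded (K \<inter> cball 0 R)" "0 \<in> K \<inter> cball 0 R"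
    using assms(4-6) R(1) by (auto intro: convex_Int)
  have LR: "convex (L \<inter> cball 0 R)" "closed (L \<inter> cball 0 R)" "bounded (L \<inter> cball 0 R)" "0 \<in> L \<inter> cball 0 R"
    using assms(8-10) R(1) by (auto intro: convex_Int)
  obtain u l where ul: "u \<in> K \<inter> cball 0 R" "l \<in> L \<inter> cball 0 R"
    and u: "\<And>v. v \<in> K \<inter> cball 0 R \<Longrightarrow> 0 \<le> chi u (v - u) + (B v l - B u l - f (v - u))"
    and l: "\<And>m. m \<in> L \<inter> cball 0 R \<Longrightarrow> 0 \<le> psi l (m - l) + (- B u m - (- B u l) - g (m - l))"
    using bounded_equilibrium[OF assms(1,2) KR(1-3) _ LR(1-3) _ c d B, of f g] KR(4) LR(4)
    by blast
  \<comment> \<open>Testing both inequalities with 0 and adding them cancels \<open>B u l\<close> and contradicts coercivity otherwise.\<close>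
  have "norm (u, l) < R"
    using u[OF KR(4)] l[OF LR(4)] R(2)[of u l]
    by (auto simp: blinfun.minus_right not_le[symmetric])
  then have norms: "norm u < R" "norm l < R"
    using norm_fst_le[of u l] norm_snd_le[of l u] by linarith+
  have Bcvx: "convex_on UNIV (\<lambda>u. B u l)" and Bconc: "convex_on UNIV (\<lambda>l. - B u l)"
    using B by (auto simp: cond_B1_def concave_on_def)
  have solves_u: "0 \<le> chi u (v - u) + (B v l - B u l - f (v - u))" if "v \<in> K" for v
    by (rule interior_solution_is_global[OF assms(11) assms(5) _ norms(1) affine_convex_on[OF Bcvx] _ u that])
      (use ul in auto)
  have solves_l: "0 \<le> psi l (m - l) + (- B u m - (- B u l) - g (m - l))" if "m \<in> L" for m
    by (rule interior_solution_is_global[OF assms(12) assms(9) _ norms(2) affine_convex_on[OF Bconc] _ l that])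
      (use ul in auto)
  show ?thesis
  proof (intro bexI[of _ u] bexI[of _ l] conjI ballI)
    show "f (v - u) \<le> B v l - B u l + chi u (v - u)" if "v \<in> K" for v
      using solves_u[OF that] by linarith
    show "g (m - l) \<le> B u l - B u m + psi l (m - l)" if "m \<in> L" for m
      using solves_l[OF that] by linarith
  qed (use ul in auto)
qed

end
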